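(* For every real $\alpha$ with $0<\alpha<1/2$ there exist positive constants $a(\alpha)$ and $b(\alpha)$ such that \[ N^{1-2\alpha}(\log N)^{a(\alpha)} \le \Gamma_\alpha(N) \le N^{1-2\alpha}(\log N)^{b(\alpha)} \] for all sufficiently large positive integers $N$.
   Context: For $0<\alpha<1/2$ and a positive integer $N$, define \[ \Gamma_\alpha(N):=\max_{|\mathcal{M}|=N}\frac{1}{N}\sum_{m,n\in\mathcal{M}}\frac{(m,n)^{2\alpha}}{(mn)^{\alpha}}, \] where the maximum is over all finite sets $\mathcal{M}$ of positive integers with exactly $N$ elements, and $(m,n)$ denotes the greatest common divisor of $m$ and $n$. *)

theory Defs
  imports "HOL-Analysis.Analysis"
begin

definition gcd_sum :: "real \<Rightarrow> nat set \<Rightarrow> real" where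
  "gcd_sum \<alpha> M = (\<Sum>m\<in>M. \<Sum>n\<in>M. real (gcd m n) powr (2*\<alpha>) / (real (m*n)) powr \<alpha>)"

text \<open>Gamma_alpha(N): the maximum (supremum; it is attained) over all sets M of
  N positive integers of (1/N) times the GCD sum.\<close>
definition Gamma :: "real \<Rightarrow> nat \<Rightarrow> real" where
  "Gamma \<alpha> N = (SUP M\<in>{M. finite M \<and> card M = N \<and> 0 \<notin> M}. gcd_sum \<alpha> M / real N)"

end

theory Submission
  imports Defs "HOL-Real_Asymp.Real_Asymp" "HOL-Computational_Algebra.Primes"
begin

text \<open>
  Lower bound: after clearing denominators, take N of the reduced fractions a/b with ab at most X.
  Any two of them have a quotient c/d in lowest terms with cd at most X squared, so every summand
  is at least X to the power -2 alpha, while there are of the order X log X such fractions; hence X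
  may be taken smaller than N by a power of log N.

  Upper bound: the kernel is a product over primes of r^|i - j| with r = p^(-alpha), where i and j
  are the exponents of p. Peeling off one prime p splits a set into fibres of sizes x_0, x_1, ...,
  and the bound |F|^(1 - alpha) |G|^(1 - alpha) for the bilinear sum over F and G is propagated at
  the cost of a factor 1 + C/p. As the sizes are integers with sum at most N, there is no cost at
  all when p exceeds a multiple of N. The product of 1 + C/p over the remaining primes is bounded
  by a power of log N.
\<close>

section \<open>Reciprocals of primes\<close>

text \<open>The obstacle: bounding each prime by the row sums of r^|i - j| costs 1 +
  O(p^(-\<alpha>)), and already over the primes up to N these factors multiply to far more than a
  power of log N. The exponent 1 - \<alpha> on each side is what saves the estimate. For F = G it
  gives |F|^(2 - 2 \<alpha>), and since 2 - 2 \<alpha> > 1, this power of the total exceeds the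
  power of the largest fibre by a term linear in the other fibres. A fibre of relative size u at
  distance d from the largest one costs 2 p^(-\<alpha> d) u^(1 - \<alpha>), twice a weighted
  geometric mean of p^(-d) and u. Where u dominates, the linear gain pays for it; elsewhere the cost
  is O(p^(-d)), and summing over d leaves O(1/p). Two sets F and G are needed even for a single M,
  because fibres belonging to different exponents are paired; positive semidefiniteness of the
  kernel leads back to one set at a time. Of the primes only the order log log N of the sum of 1/p
  is used, so crude constants suffice: they only enlarge b.\<close>

lemma sum_ln_prime_divisors_le:
  fixes m :: nat
  assumes "m > 0"
  shows "(\<Sum>p | prime p \<and> p dvd m. ln (real p)) \<le> ln (real m)"
proof -
  have fin: "finite {p. prime p \<and> p dvd m}" using assms by auto
  have "\<Prod>Q dvd m" if "finite Q" "Q \<subseteq> {p. prime p \<and> p dvd m}" for Q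
    using that
  proof (induction Q rule: finite_induct)
    case (insert q Q)
    have "coprime q (\<Prod>Q)"
      using insert by (intro prod_coprime_right) (auto intro!: primes_coprime)
    then show ?case using insert by (auto intro!: divides_mult)
  qed simp
  from this[OF fin] have "\<Prod>{p. prime p \<and> p dvd m} dvd m" by simp
  then have "real (\<Prod>{p. prime p \<and> p dvd m}) \<le> real m"
    using assms dvd_imp_le of_nat_le_iff by blast
  moreover have "(\<Sum>p | prime p \<and> p dvd m. ln (real p)) = ln (real (\<Prod>{p. prime p \<and> p dvd m}))"
    by (subst of_nat_prod, subst ln_prod) (auto simp: prime_gt_0_nat fin)
  moreover have "\<Prod>{p. prime p \<and> p dvd m} > 0" by (auto intro!: prod_pos simp: prime_gt_0_nat)
  ultimately show ?thesis by (metis ln_mono of_nat_0_less_iff)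
qed

text \<open>Upper half of Mertens' first theorem with a crude constant. Pairs
  \<open>p dvd m\<close>, \<open>m \<le> n\<close>, weighted by ln p, are counted twice: by
  \<open>p\<close> they give \<open>n div p\<close> multiples, by \<open>m\<close> at most ln
  m.\<close>

lemma sum_ln_over_primes_le:
  fixes x :: real
  assumes "x \<ge> 1"
  shows "(\<Sum>p | prime p \<and> real p \<le> x. ln (real p) / real p) \<le> 2 * ln x"
proof -
  define n where "n = nat \<lfloor>x\<rfloor>"
  have n: "n \<ge> 1" "real n \<le> x" using assms unfolding n_def by linarith+
  define P where "P = {p::nat. prime p \<and> p \<le> n}"
  have P: "{p. prime p \<and> real p \<le> x} = P"
    unfolding P_def n_def using assms by (auto simp: le_nat_floor le_nat_iff le_floor_iff)
  have fin: "finite P" unfolding P_def by auto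
  have "(\<Sum>p\<in>P. ln (real p) * (real n / (2 * real p))) \<le> (\<Sum>p\<in>P. ln (real p) * real (n div p))"
  proof (intro sum_mono mult_left_mono)
    fix p assume p: "p \<in> P"
    then have p0: "p > 0" "p \<le> n" by (auto simp: P_def prime_gt_0_nat)
    \<comment> \<open>As the quotient is at least 1, the remainder is below p * (n div p), so
      rounding down loses at most a factor 2; this is the 2 in the statement.\<close>
    have "n div p \<ge> 1" using p0 by (simp add: Suc_le_eq div_greater_zero_iff)
    moreover have "n < p * (n div p) + p"
      using p0 by (metis add.commute mod_less_divisor mult_div_mod_eq nat_add_left_cancel_less)
    ultimately have "n \<le> 2 * p * (n div p)"
      by (smt (verit) One_nat_def add_le_mono le_trans less_imp_le_nat mult.assoc mult.commute mult_2 mult_le_mono2 nat_mult_1_right order_refl)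
    then have "real n \<le> 2 * real p * real (n div p)"
      by (metis of_nat_le_iff of_nat_mult of_nat_numeral)
    then show "real n / (2 * real p) \<le> real (n div p)" using p0 by (simp add: field_simps)
    show "0 \<le> ln (real p)" using p0 by simp
  qed
  also have "\<dots> = (\<Sum>p\<in>P. \<Sum>m\<in>{m\<in>{1..n}. p dvd m}. ln (real p))"
  proof (rule sum.cong)
    fix p assume p: "p \<in> P"
    then have p0: "p > 0" by (auto simp: P_def prime_gt_0_nat)
    have "{m\<in>{1..n}. p dvd m} = (\<lambda>k. p * k) ` {1..n div p}"
      using p0 by (auto simp: image_iff Bex_def less_eq_div_iff_mult_less_eq mult.commute elim!: dvdE)
    moreover have "card ((\<lambda>k. p * k) ` {1..n div p}) = n div p"
      using p0 by (subst card_image) (auto simp: inj_on_def)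
    ultimately show "ln (real p) * real (n div p) = (\<Sum>m\<in>{m\<in>{1..n}. p dvd m}. ln (real p))" by simp
  qed simp
  also have "\<dots> = (\<Sum>m\<in>{1..n}. \<Sum>p\<in>{p\<in>P. p dvd m}. ln (real p))"
    by (rule sum.swap_restrict) (use fin in auto)
  also have "\<dots> \<le> (\<Sum>m\<in>{1..n}. ln (real n))"
  proof (rule sum_mono)
    fix m assume m: "m \<in> {1..n}"
    then have "{p\<in>P. p dvd m} = {p. prime p \<and> p dvd m}"
      unfolding P_def by (auto dest: dvd_imp_le)
    then have "(\<Sum>p\<in>{p\<in>P. p dvd m}. ln (real p)) \<le> ln (real m)"
      using sum_ln_prime_divisors_le[of m] m by simp
    also have "\<dots> \<le> ln (real n)" using m by simp
    finally show "(\<Sum>p\<in>{p\<in>P. p dvd m}. ln (real p)) \<le> ln (real n)" .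
  qed
  also have "\<dots> = real n * ln (real n)" by simp
  finally have "real n / 2 * (\<Sum>p\<in>P. ln (real p) / real p) \<le> real n * ln (real n)"
    by (simp add: sum_distrib_left field_simps)
  then have "(\<Sum>p\<in>P. ln (real p) / real p) \<le> 2 * ln (real n)" using n by (simp add: field_simps)
  also have "\<dots> \<le> 2 * ln x" using n by simp
  finally show ?thesis by (simp add: P)
qed

lemma finite_primes_le: "finite {p::nat. prime p \<and> real p \<le> x}"
  by (rule finite_subset[of _ "{..nat \<lfloor>x\<rfloor>}"]) (auto simp: le_nat_floor)

text \<open>Replaces partial summation. For primes between exp (2^k) and exp (2^(k+1)) the factor ln
  p is at least 2^k, so 1/p is at most (ln p / p) / 2^k, and each such window contributes at most 2
  * 2^(k+1) / 2^k = 4.\<close>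

lemma sum_inverse_primes_dyadic:
  "(\<Sum>p | prime p \<and> real p \<le> exp (2 ^ k). 1 / real p) \<le> 1 + 4 * real k"
proof (induction k)
  case 0
  have "{p::nat. prime p \<and> real p \<le> exp (2 ^ 0)} \<subseteq> {2}"
  proof
    fix p :: nat assume p: "p \<in> {p. prime p \<and> real p \<le> exp (2 ^ 0)}"
    then have "real p < 3" using e_less_272 by simp
    moreover have "p \<ge> 2" using p prime_ge_2_nat by auto
    ultimately show "p \<in> {2}" by simp
  qed
  then have "(\<Sum>p | prime p \<and> real p \<le> exp (2 ^ 0). 1 / real p) \<le> (\<Sum>p\<in>{2::nat}. 1 / real p)"
    by (intro sum_mono2) auto
  then show ?case by simp
next
  case (Suc k)
  let ?A = "\<lambda>k. {p::nat. prime p \<and> real p \<le> exp (2 ^ k)}"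
  have sub: "?A k \<subseteq> ?A (Suc k)"
    by (auto intro: order.trans)
  have fin: "finite (?A (Suc k))" by (rule finite_primes_le)
  have "(\<Sum>p\<in>?A (Suc k) - ?A k. 1 / real p) \<le> (\<Sum>p\<in>?A (Suc k) - ?A k. (ln (real p) / real p) / 2 ^ k)"
  proof (rule sum_mono)
    fix p assume p: "p \<in> ?A (Suc k) - ?A k"
    then have p0: "p > 0" "real p > exp (2 ^ k)" by (auto simp: prime_gt_0_nat)
    then have "ln (real p) \<ge> 2 ^ k" by (simp add: ln_ge_iff)
    then show "1 / real p \<le> (ln (real p) / real p) / 2 ^ k" using p0 by (simp add: field_simps)
  qed
  also have "\<dots> \<le> (\<Sum>p\<in>?A (Suc k). (ln (real p) / real p) / 2 ^ k)"
    using fin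
    by (intro sum_mono2) (auto simp: prime_gt_0_nat intro!: divide_nonneg_nonneg ln_ge_zero dest: prime_ge_1_nat)
  also have "\<dots> = (\<Sum>p\<in>?A (Suc k). ln (real p) / real p) / 2 ^ k"
    by (simp add: sum_divide_distrib)
  also have "\<dots> \<le> (2 * ln (exp (2 ^ Suc k))) / 2 ^ k"
    by (intro divide_right_mono sum_ln_over_primes_le) auto
  also have "\<dots> = 4" by simp
  finally have "(\<Sum>p\<in>?A (Suc k) - ?A k. 1 / real p) \<le> 4" .
  then show ?case using Suc.IH sum.subset_diff[OF sub fin, of "\<lambda>p. 1 / real p"] by simp
qed

lemma sum_inverse_primes_le:
  fixes x :: real
  assumes "x \<ge> exp 1"
  shows "(\<Sum>p | prime p \<and> real p \<le> x. 1 / real p) \<le> 5 + 6 * ln (ln x)"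
proof -
  have x0: "x > 0" using assms by (meson exp_gt_zero less_le_trans)
  have l1: "ln x \<ge> 1" using assms x0 by (simp add: ln_ge_iff)
  define k where "k = nat \<lceil>log 2 (ln x)\<rceil>"
  have lg: "log 2 (ln x) \<ge> 0" using l1 by simp
  have k: "log 2 (ln x) \<le> real k" "real k \<le> log 2 (ln x) + 1"
    unfolding k_def using lg by linarith+
  have "ln x \<le> 2 powr real k" using k(1) l1 by (simp add: log_le_iff)
  then have "ln x \<le> 2 ^ k" by (simp add: powr_realpow)
  then have "x \<le> exp (2 ^ k)" using x0 by (metis exp_le_cancel_iff exp_ln)
  then have "(\<Sum>p | prime p \<and> real p \<le> x. 1 / real p) \<le> (\<Sum>p | prime p \<and> real p \<le> exp (2 ^ k). 1 / real p)"
    by (intro sum_mono2) (auto simp: finite_primes_le)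
  also have "\<dots> \<le> 1 + 4 * real k" by (rule sum_inverse_primes_dyadic)
  also have "\<dots> \<le> 5 + 4 * log 2 (ln x)" using k by simp
  \<comment> \<open>Since ln 2 is at least 2/3, the coefficient 4 of the binary logarithm becomes 6;
    rounding up to \<open>k\<close> has turned 1 into 5.\<close>
  also have "log 2 (ln x) \<le> 3 / 2 * ln (ln x)"
  proof -
    have "ln (ln x) \<ge> 0" using l1 by simp
    then have "2 / 3 * ln (ln x) \<le> ln 2 * ln (ln x)" by (intro mult_right_mono ln2_ge_two_thirds)
    then show ?thesis by (simp add: log_def field_simps) 
  qed
  finally show ?thesis by simp
qed

section \<open>The kernel of a single prime\<close>

text \<open>Weighted AM-GM for \<open>1 + s * x\<close> and 1 with weights 1/s and 1 - 1/s, raised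
  to the power s.\<close>

lemma Bernoulli_powr:
  fixes x s :: real
  assumes "x \<ge> 0" "s \<ge> 1"
  shows "1 + s * x \<le> (1 + x) powr s"
proof -
  have "(1 + s * x) powr (1 / s) * 1 powr (1 - 1 / s) \<le> (1 / s) * (1 + s * x) + (1 - 1 / s) * 1"
    using assms by (intro Youngs_inequality_0) (auto intro: add_pos_nonneg)
  also have "\<dots> = 1 + x" using assms by (simp add: field_simps)
  finally have "((1 + s * x) powr (1 / s)) powr s \<le> (1 + x) powr s"
    using assms by (intro powr_mono2) auto
  then show ?thesis using assms by (simp add: powr_powr)
qed

text \<open>With truncated subtraction, (i - j) + (j - i) is the distance of i and j.\<close>

lemma sum_power_dist_le:
  fixes q :: real
  assumes "0 \<le> q" "q < 1"
  shows "(\<Sum>j\<le>J. q ^ ((i - j) + (j - i))) \<le> (1 + q) / (1 - q)"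
proof -
  have geo: "(\<Sum>j\<in>A. q ^ j) \<le> 1 / (1 - q)" if "finite A" for A
    using sum_le_suminf[of "\<lambda>j. q ^ j" A] assms that by (simp add: summable_geometric suminf_geometric)
  have "(\<Sum>j\<le>J. q ^ ((i - j) + (j - i))) =
      (\<Sum>j\<in>{..J} \<inter> {i..}. q ^ (j - i)) + (\<Sum>j\<in>{..J} \<inter> {..<i}. q ^ (i - j))"
  proof -
    have "{..J} = ({..J} \<inter> {i..}) \<union> ({..J} \<inter> {..<i})" by auto
    then have "(\<Sum>j\<le>J. q ^ ((i - j) + (j - i))) =
      (\<Sum>j\<in>({..J} \<inter> {i..}) \<union> ({..J} \<inter> {..<i}). q ^ ((i - j) + (j - i)))" by simp
    also have "\<dots> = (\<Sum>j\<in>{..J} \<inter> {i..}. q ^ ((i - j) + (j - i))) + (\<Sum>j\<in>{..J} \<inter> {..<i}. q ^ ((i - j) + (j - i)))"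
      by (rule sum.union_disjoint) auto
    finally show ?thesis by simp
  qed
  also have "(\<Sum>j\<in>{..J} \<inter> {i..}. q ^ (j - i)) = (\<Sum>j\<in>(\<lambda>j. j - i) ` ({..J} \<inter> {i..}). q ^ j)"
    by (subst sum.reindex) (auto simp: inj_on_def)
  also have "\<dots> \<le> 1 / (1 - q)" by (rule geo) auto
  also have "(\<Sum>j\<in>{..J} \<inter> {..<i}. q ^ (i - j)) = (\<Sum>j\<in>{..J} \<inter> {..<i}. q * q ^ (i - j - 1))"
  proof (rule sum.cong)
    fix j assume "j \<in> {..J} \<inter> {..<i}"
    then have "i - j = Suc (i - j - 1)" by auto
    then show "q ^ (i - j) = q * q ^ (i - j - 1)" by (metis power_Suc)
  qed simp
  also have "\<dots> = q * (\<Sum>j\<in>(\<lambda>j. i - j - 1) ` ({..J} \<inter> {..<i}). q ^ j)"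
    by (subst sum.reindex) (auto simp: inj_on_def sum_distrib_left)
  also have "\<dots> \<le> q * (1 / (1 - q))" using assms by (intro mult_left_mono geo) auto
  finally show ?thesis by (simp add: add_divide_distrib)
qed

text \<open>The Schur test: 2 z_i z_j is at most z_i^2 + z_j^2, and every row sum is at most (1 + r)
  / (1 - r). The index set \<open>A\<close> is arbitrary because the form is also needed with the
  index of the largest entry removed.\<close>

lemma power_dist_form_le_sum_squares:
  fixes r :: real and z :: "nat \<Rightarrow> real"
  assumes "0 \<le> r" "r < 1" "A \<subseteq> {..J}"
  shows "(\<Sum>i\<in>A. \<Sum>j\<in>A. r ^ ((i - j) + (j - i)) * z i * z j) \<le> (1 + r) / (1 - r) * (\<Sum>i\<in>A. (z i)\<^sup>2)"
proof -
  let ?d = "\<lambda>i j. (i - j) + (j - i) :: nat"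
  have fin: "finite A" using assms(3) finite_subset by blast
  have "(\<Sum>i\<in>A. \<Sum>j\<in>A. r ^ ?d i j * z i * z j)
      \<le> (\<Sum>i\<in>A. \<Sum>j\<in>A. r ^ ?d i j * (z i)\<^sup>2 / 2 + r ^ ?d j i * (z j)\<^sup>2 / 2)"
  proof (intro sum_mono)
    fix i j
    have "z i * z j \<le> ((z i)\<^sup>2 + (z j)\<^sup>2) / 2" using sum_squares_bound[of "z i" "z j"] by simp
    then have "r ^ ?d i j * (z i * z j) \<le> r ^ ?d i j * (((z i)\<^sup>2 + (z j)\<^sup>2) / 2)"
      using assms by (intro mult_left_mono) auto
    then show "r ^ ?d i j * z i * z j \<le> r ^ ?d i j * (z i)\<^sup>2 / 2 + r ^ ?d j i * (z j)\<^sup>2 / 2"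
      by (simp add: algebra_simps)
  qed
  also have "\<dots> = (\<Sum>i\<in>A. \<Sum>j\<in>A. r ^ ?d i j * (z i)\<^sup>2 / 2) + (\<Sum>i\<in>A. \<Sum>j\<in>A. r ^ ?d j i * (z j)\<^sup>2 / 2)"
    by (simp add: sum.distrib)
  also have "(\<Sum>i\<in>A. \<Sum>j\<in>A. r ^ ?d j i * (z j)\<^sup>2 / 2) = (\<Sum>i\<in>A. \<Sum>j\<in>A. r ^ ?d i j * (z i)\<^sup>2 / 2)"
    by (rule sum.swap)
  also have "(\<Sum>i\<in>A. \<Sum>j\<in>A. r ^ ?d i j * (z i)\<^sup>2 / 2) + (\<Sum>i\<in>A. \<Sum>j\<in>A. r ^ ?d i j * (z i)\<^sup>2 / 2)
      = (\<Sum>i\<in>A. (\<Sum>j\<in>A. r ^ ?d i j) * (z i)\<^sup>2)"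
    by (simp add: sum_distrib_left mult.commute flip: sum.distrib)
  also have "\<dots> \<le> (\<Sum>i\<in>A. (1 + r) / (1 - r) * (z i)\<^sup>2)"
  proof (intro sum_mono mult_right_mono)
    fix i
    have "(\<Sum>j\<in>A. r ^ ?d i j) \<le> (\<Sum>j\<le>J. r ^ ?d i j)"
      using assms by (intro sum_mono2) auto
    also have "\<dots> \<le> (1 + r) / (1 - r)" using assms by (intro sum_power_dist_le) auto
    finally show "(\<Sum>j\<in>A. r ^ ?d i j) \<le> (1 + r) / (1 - r)" .
  qed simp
  finally show ?thesis by (simp add: sum_distrib_left)
qed

text \<open>Each entry is at most the total X, so x^s = x * x^(s-1) is at most x * X^(s-1).\<close>

lemma sum_powr_le_powr_sum:
  fixes x :: "'a \<Rightarrow> real"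
  assumes "finite A" "\<And>i. i \<in> A \<Longrightarrow> x i \<ge> 0" "s \<ge> 1"
  shows "(\<Sum>i\<in>A. x i powr s) \<le> (\<Sum>i\<in>A. x i) powr s"
proof (cases "(\<Sum>i\<in>A. x i) = 0")
  case True
  then have "x i = 0" if "i \<in> A" for i using assms that by (simp add: sum_nonneg_eq_0_iff)
  then show ?thesis by simp
next
  case False
  define X where "X = (\<Sum>i\<in>A. x i)"
  have X: "X > 0" using False assms unfolding X_def by (simp add: order_less_le sum_nonneg)
  have split: "y powr s = y * y powr (s - 1)" if "y \<ge> 0" for y :: real
    using that by (metis diff_add_cancel mult.commute powr_add powr_one powr_zero_eq_one mult_zero_left powr_0 less_eq_real_def)
  have "(\<Sum>i\<in>A. x i powr s) \<le> (\<Sum>i\<in>A. x i * X powr (s - 1))"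
  proof (rule sum_mono)
    fix i assume i: "i \<in> A"
    have "x i \<le> X" unfolding X_def using assms i by (intro member_le_sum) auto
    then have "x i powr (s - 1) \<le> X powr (s - 1)" using assms i by (intro powr_mono2) auto
    then show "x i powr s \<le> x i * X powr (s - 1)"
      using split[of "x i"] assms i by (simp add: mult_left_mono)
  qed
  also have "\<dots> = X powr s" using split[of X] X by (simp add: X_def sum_distrib_right)
  finally show ?thesis unfolding X_def .
qed

text \<open>The linear term in the deviation from the maximal entry is absorbed by Bernoulli's
  inequality, since the exponent 2 - 2 alpha exceeds 1.\<close>

lemma power_dist_form_normalized_le:
  fixes \<alpha> p E \<kappa> r :: real and u :: "nat \<Rightarrow> real"
  assumes \<alpha>: "0 < \<alpha>" "\<alpha> < 1/2" and p: "p \<ge> 2" and "E \<ge> 0"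
    and \<kappa>: "\<kappa> = (1 - 2 * \<alpha>) / 2" and r: "0 \<le> r" "r \<le> \<kappa> / (2 + \<kappa>)"
    and u: "\<And>j. j \<le> J \<Longrightarrow> 0 \<le> u j" "\<And>j. j \<le> J \<Longrightarrow> u j \<le> 1" and I: "I \<le> J" "u I = 1"
    and off: "\<And>j. j \<le> J \<Longrightarrow> j \<noteq> I \<Longrightarrow>
      2 * r ^ ((I - j) + (j - I)) * u j powr (1 - \<alpha>) \<le> \<kappa> * u j + E * (1 / p) ^ ((I - j) + (j - I))"
  shows "(\<Sum>i\<le>J. \<Sum>j\<le>J. r ^ ((i - j) + (j - i)) * u i powr (1 - \<alpha>) * u j powr (1 - \<alpha>))
    \<le> (1 + 4 * E / p) * (\<Sum>j\<le>J. u j) powr (2 - 2 * \<alpha>)"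
proof -
  let ?d = "\<lambda>i j. (i - j) + (j - i) :: nat"
  define z where "z j = u j powr (1 - \<alpha>)" for j
  define A where "A = {..J} - {I}"
  define y where "y = (\<Sum>j\<in>A. u j)"
  have \<kappa>0: "\<kappa> > 0" using \<alpha> \<kappa> by simp
  have r1: "r < 1" using r(2) \<kappa>0 by (smt (verit) divide_less_eq_1)
  have zI: "z I = 1" by (simp add: z_def I)
  have ins: "{..J} = insert I A" and A: "finite A" "I \<notin> A" "A \<subseteq> {..J}" using I by (auto simp: A_def)
  have y0: "y \<ge> 0" unfolding y_def using u A by (intro sum_nonneg) auto
  have tot: "(\<Sum>j\<le>J. u j) = 1 + y" unfolding ins y_def using A I by simp
  have "(\<Sum>i\<le>J. \<Sum>j\<le>J. r ^ ?d i j * z i * z j) =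
     1 + (\<Sum>j\<in>A. r ^ ?d I j * z j) + (\<Sum>i\<in>A. r ^ ?d i I * z i) + (\<Sum>i\<in>A. \<Sum>j\<in>A. r ^ ?d i j * z i * z j)"
    unfolding ins using A zI by (simp add: sum.distrib)
  also have "(\<Sum>i\<in>A. r ^ ?d i I * z i) = (\<Sum>j\<in>A. r ^ ?d I j * z j)"
    by (simp add: add.commute)
  also have "1 + (\<Sum>j\<in>A. r ^ ?d I j * z j) + (\<Sum>j\<in>A. r ^ ?d I j * z j) = 1 + (\<Sum>j\<in>A. 2 * r ^ ?d I j * z j)"
    by (simp add: sum_distrib_left[symmetric] mult.assoc)
  also have "(\<Sum>j\<in>A. 2 * r ^ ?d I j * z j) \<le> (\<Sum>j\<in>A. \<kappa> * u j + E * (1 / p) ^ ?d I j)"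
    unfolding z_def using A by (intro sum_mono off) (auto simp: A_def)
  also have "\<dots> = \<kappa> * y + E * (\<Sum>j\<in>A. (1 / p) ^ ?d I j)"
    by (simp add: y_def sum.distrib sum_distrib_left)
  also have "E * (\<Sum>j\<in>A. (1 / p) ^ ?d I j) \<le> E * (4 / p)"
  proof (rule mult_left_mono)
    \<comment> \<open>Index \<open>I\<close> is put back with its value 1 to get a complete row; the
      excess 2 / (p - 1) over 1 is at most 4 / p because p is at least 2.\<close>
    have "1 + (\<Sum>j\<in>A. (1 / p) ^ ?d I j) = (\<Sum>j\<le>J. (1 / p) ^ ?d I j)"
      unfolding ins using A by simp
    also have "\<dots> \<le> (1 + 1 / p) / (1 - 1 / p)" using p by (intro sum_power_dist_le) auto
    also have "\<dots> \<le> 1 + 4 / p" using p by (simp add: field_simps)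
    finally show "(\<Sum>j\<in>A. (1 / p) ^ ?d I j) \<le> 4 / p" by simp
  qed fact
  also have "(\<Sum>i\<in>A. \<Sum>j\<in>A. r ^ ?d i j * z i * z j) \<le> (1 + r) / (1 - r) * (\<Sum>i\<in>A. (z i)\<^sup>2)"
    by (rule power_dist_form_le_sum_squares) (use r r1 A in auto)
  \<comment> \<open>The hypothesis on \<open>r\<close> is exactly what makes the Schur constant at
    most 1 + \<kappa>. The squares are u^(2 - 2 \<alpha>), hence at most u because u lies in
    [0, 1].\<close>
  also have "\<dots> \<le> (1 + \<kappa>) * y"
  proof (rule mult_mono)
    have "r * (2 + \<kappa>) \<le> \<kappa>" using r(2) \<kappa>0 by (simp add: field_simps)
    then show "(1 + r) / (1 - r) \<le> 1 + \<kappa>" using r1 by (simp add: field_simps)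
    show "(\<Sum>i\<in>A. (z i)\<^sup>2) \<le> y" unfolding y_def
    proof (rule sum_mono)
      fix i assume "i \<in> A"
      then have ui: "0 \<le> u i" "u i \<le> 1" using A u by auto
      have "(z i)\<^sup>2 = u i powr (2 - 2 * \<alpha>)" unfolding z_def using ui
        by (simp add: power2_eq_square powr_add[symmetric])
      also have "\<dots> \<le> u i powr 1" using ui \<alpha> by (intro powr_mono') auto
      finally show "(z i)\<^sup>2 \<le> u i" using ui by simp
    qed
  qed (use \<kappa>0 y0 in \<open>auto intro: sum_nonneg\<close>)
  \<comment> \<open>The cross terms use \<kappa> and the remaining block 1 + \<kappa>; \<kappa> is
    chosen so that 1 + 2 \<kappa> = 2 - 2 \<alpha>, the slope that Bernoulli's inequality can
    absorb.\<close>
  also have "1 + (\<kappa> * y + E * (4 / p)) + (1 + \<kappa>) * y = 1 + (2 - 2 * \<alpha>) * y + 4 * E / p"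
    unfolding \<kappa> by (simp add: field_simps)
  finally have "(\<Sum>i\<le>J. \<Sum>j\<le>J. r ^ ?d i j * z i * z j) \<le> 1 + (2 - 2 * \<alpha>) * y + 4 * E / p"
    by simp
  also have "1 + (2 - 2 * \<alpha>) * y \<le> (1 + y) powr (2 - 2 * \<alpha>)"
    using y0 \<alpha> by (intro Bernoulli_powr) auto
  also have "4 * E / p \<le> 4 * E / p * (1 + y) powr (2 - 2 * \<alpha>)"
  proof -
    have "1 \<le> (1 + y) powr (2 - 2 * \<alpha>)" using y0 \<alpha> by (intro ge_one_powr_ge_zero) auto
    then show ?thesis using \<open>E \<ge> 0\<close> p mult_left_mono[of 1 "(1 + y) powr (2 - 2 * \<alpha>)" "4 * E / p"] by simp
  qed
  finally show ?thesis by (simp add: z_def tot algebra_simps)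
qed


text \<open>\<open>p\<close> is real because the one-prime estimate is stated for every real p \<ge>
  2. \<open>N\<close> bounds the total of all entries and not one fibre, so the same factor serves
  at every level of the induction over the primes.\<close>

definition prime_loss :: "real \<Rightarrow> real \<Rightarrow> nat \<Rightarrow> real \<Rightarrow> real" where
  "prime_loss Q C N p = (if p < Q * real N then 1 + C / p else 1)"

text \<open>\<open>Q\<close> and \<open>C\<close> depend on \<alpha> alone. For p < Q the Schur test
  is good enough; for p \<ge> Q the entries are divided by the largest one and the normalized
  estimate applies.\<close>

lemma power_dist_form_le:
  fixes \<alpha> :: real
  assumes \<alpha>: "0 < \<alpha>" "\<alpha> < 1/2"
  shows "\<exists>Q\<ge>1. \<exists>C>0. \<forall>p\<ge>2. \<forall>N J. \<forall>x :: nat \<Rightarrow> nat. (\<Sum>j\<le>J. x j) \<le> N \<longrightarrow>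
    (\<Sum>i\<le>J. \<Sum>j\<le>J. (p powr - \<alpha>) ^ ((i - j) + (j - i)) * real (x i) powr (1 - \<alpha>) * real (x j) powr (1 - \<alpha>))
    \<le> prime_loss Q C N p * real (\<Sum>j\<le>J. x j) powr (2 - 2 * \<alpha>)"
proof -
  define \<kappa> where "\<kappa> = (1 - 2 * \<alpha>) / 2"
  have \<kappa>0: "\<kappa> > 0" using \<alpha> by (simp add: \<kappa>_def)
  \<comment> \<open>Makes Q^(-\<alpha>) equal to the bound that the normalized estimate imposes on
    \<open>r\<close>, which therefore holds for p \<ge> Q.\<close>
  define Q where "Q = ((2 + \<kappa>) / \<kappa>) powr (1 / \<alpha>)"
  have Q1: "Q \<ge> 1" unfolding Q_def using \<kappa>0 \<alpha> by (intro ge_one_powr_ge_zero) (auto simp: field_simps)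
  have Q\<alpha>: "Q powr - \<alpha> = \<kappa> / (2 + \<kappa>)"
    unfolding Q_def using \<kappa>0 \<alpha> by (simp add: powr_powr powr_minus)
  \<comment> \<open>The Schur constant at p = 2, the worst case.\<close>
  define R where "R = (1 + 2 powr - \<alpha>) / (1 - 2 powr - \<alpha>)"
  have two: "2 powr - \<alpha> < (1::real)" using \<alpha> by (simp add: powr_less_one)
  have R0: "R \<ge> 0" unfolding R_def using two by (intro divide_nonneg_nonneg) auto
  \<comment> \<open>8 Q is 4 E for the error coefficient E = 2 Q used when p \<ge> Q; R Q covers p <
    Q.\<close>
  define C where "C = 8 * Q + R * Q"
  have C0: "C > 0" unfolding C_def using Q1 R0 by (intro add_pos_nonneg mult_nonneg_nonneg) auto
  show ?thesis
  proof (rule exI[of _ Q], rule conjI[OF Q1], rule exI[of _ C], rule conjI[OF C0], intro allI impI)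
    fix p :: real and N J :: nat and x :: "nat \<Rightarrow> nat"
    assume p: "2 \<le> p" and N: "(\<Sum>j\<le>J. x j) \<le> N"
    let ?d = "\<lambda>i j. (i - j) + (j - i) :: nat"
    define r where "r = p powr - \<alpha>"
    have r0: "0 \<le> r" by (simp add: r_def)
    define X where "X = (\<Sum>j\<le>J. x j)"
    define z where "z j = real (x j) powr (1 - \<alpha>)" for j
    have "(\<Sum>i\<le>J. \<Sum>j\<le>J. r ^ ?d i j * z i * z j) \<le> prime_loss Q C N p * real X powr (2 - 2 * \<alpha>)"
    proof (cases "X = 0")
      case True
      then have "z j = 0" if "j \<le> J" for j using that by (simp add: X_def z_def)
      then show ?thesis using True by simp
    next
      case False
      then have N1: "N \<ge> 1" using N unfolding X_def by linarith
      show ?thesis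
      proof (cases "p < Q")
        case True
        have "Q * 1 \<le> Q * real N" using N1 Q1 by (intro mult_left_mono) auto
        then have pQ: "p < Q * real N" using True by linarith
        have r2: "r \<le> 2 powr - \<alpha>" unfolding r_def using p \<alpha> by (intro powr_mono2') auto
        have "(\<Sum>i\<le>J. \<Sum>j\<le>J. r ^ ?d i j * z i * z j) \<le> (1 + r) / (1 - r) * (\<Sum>i\<le>J. (z i)\<^sup>2)"
          by (rule power_dist_form_le_sum_squares) (use r0 r2 two in auto)
        also have "\<dots> \<le> prime_loss Q C N p * real X powr (2 - 2 * \<alpha>)"
        proof (rule mult_mono)
          have "(1 + r) / (1 - r) \<le> R" unfolding R_def using r0 r2 two by (intro frac_le) auto
          \<comment> \<open>Below \<open>Q\<close> the quotient Q / p exceeds 1, so a constant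
            factor can be charged as C / p.\<close>
          also have "R * 1 \<le> R * (Q / p)" using True p by (intro mult_left_mono R0) auto
          then have "R \<le> R * Q / p" by simp
          also have "\<dots> \<le> C / p" unfolding C_def using p Q1 by (intro divide_right_mono) auto
          finally show "(1 + r) / (1 - r) \<le> prime_loss Q C N p" using pQ by (simp add: prime_loss_def)
          have "(\<Sum>i\<le>J. (z i)\<^sup>2) = (\<Sum>i\<le>J. real (x i) powr (2 - 2 * \<alpha>))"
            unfolding z_def by (intro sum.cong refl) (simp add: power2_eq_square powr_add[symmetric])
          also have "\<dots> \<le> (\<Sum>i\<le>J. real (x i)) powr (2 - 2 * \<alpha>)"
            using \<alpha> by (intro sum_powr_le_powr_sum) auto
          finally show "(\<Sum>i\<le>J. (z i)\<^sup>2) \<le> real X powr (2 - 2 * \<alpha>)" by (simp add: X_def)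
        qed (use C0 p in \<open>auto simp: prime_loss_def intro: sum_nonneg\<close>)
        finally show ?thesis .
      next
        case pQ: False
        obtain I where I: "I \<le> J" and Imax: "\<And>j. j \<le> J \<Longrightarrow> x j \<le> x I"
        proof -
          have "Max (x ` {..J}) \<in> x ` {..J}" by (intro Max_in) auto
          then obtain I where "I \<le> J" "x I = Max (x ` {..J})" by (metis (no_types, lifting) atMost_iff imageE)
          then show ?thesis using that[of I] by simp
        qed
        have xI: "x I > 0"
        proof (rule ccontr)
          assume "\<not> x I > 0"
          then have "x j = 0" if "j \<le> J" for j using Imax[OF that] by simp
          then show False using \<open>X \<noteq> 0\<close> by (simp add: X_def)
        qed
        have xIN: "x I \<le> N"
          using N member_le_sum[of I "{..J}" x] I by simp
        define u where "u j = real (x j) / real (x I)" for j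
        \<comment> \<open>A zero error coefficient beyond the threshold is what makes the loss
          exactly 1 there.\<close>
        define E where "E = (if p < Q * real N then 2 * Q else 0)"
        have "(\<Sum>i\<le>J. \<Sum>j\<le>J. r ^ ?d i j * u i powr (1 - \<alpha>) * u j powr (1 - \<alpha>))
            \<le> (1 + 4 * E / p) * (\<Sum>j\<le>J. u j) powr (2 - 2 * \<alpha>)"
        proof (rule power_dist_form_normalized_le[where \<kappa> = \<kappa> and I = I])
          have "r \<le> Q powr - \<alpha>" unfolding r_def using pQ Q1 \<alpha> by (intro powr_mono2') auto
          then show "r \<le> \<kappa> / (2 + \<kappa>)" by (simp add: Q\<alpha>)
          show "E \<ge> 0" using Q1 by (simp add: E_def)
          fix j assume j: "j \<le> J"
          show "0 \<le> u j" by (simp add: u_def)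
          show "u j \<le> 1" using Imax[OF j] xI by (simp add: u_def)
          assume "j \<noteq> I"
          define v where "v = (1 / p) ^ ?d I j"
          have v0: "v > 0" using p by (simp add: v_def)
          have rv: "r ^ ?d I j = v powr \<alpha>"
            using p by (simp add: r_def v_def powr_minus powr_divide powr_power powr_realpow[symmetric] powr_powr inverse_eq_divide power_one_over mult.commute)
          have vp: "v \<le> 1 / p"
          proof -
            have "?d I j \<ge> 1" using \<open>j \<noteq> I\<close> by arith
            then have "(1 / p) ^ ?d I j \<le> (1 / p) ^ 1" using p by (intro power_decreasing) auto
            then show ?thesis by (simp add: v_def)
          qed
          have u0: "u j \<ge> 0" by (simp add: u_def)
          \<comment> \<open>A weighted geometric mean of \<open>v\<close> and \<open>u j\<close>. If
            \<open>u j\<close> is at least Q v, the factor Q^(-\<alpha>) \<le> \<kappa> / 2 fits it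
            into \<kappa> u; otherwise it is at most Q v.\<close>
          have "2 * (v powr \<alpha> * u j powr (1 - \<alpha>)) \<le> \<kappa> * u j + E * v"
          proof (cases "u j \<ge> Q * v")
            case True
            have "v powr \<alpha> \<le> (u j / Q) powr \<alpha>"
              using True v0 Q1 \<alpha> by (intro powr_mono2) (auto simp: field_simps)
            also have "\<dots> = Q powr - \<alpha> * u j powr \<alpha>"
              using u0 Q1 by (simp add: powr_divide powr_minus field_simps)
            finally have "v powr \<alpha> * u j powr (1 - \<alpha>) \<le> Q powr - \<alpha> * u j powr \<alpha> * u j powr (1 - \<alpha>)"
              by (intro mult_right_mono) auto
            also have "\<dots> = Q powr - \<alpha> * u j"
              using u0 by (simp add: mult.assoc powr_add[symmetric])
            also have "\<dots> \<le> \<kappa> / 2 * u j"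
              unfolding Q\<alpha> using u0 \<kappa>0 by (intro mult_right_mono) (auto simp: field_simps)
            finally have "2 * (v powr \<alpha> * u j powr (1 - \<alpha>)) \<le> \<kappa> * u j" by simp
            moreover have "E * v \<ge> 0" using v0 Q1 by (simp add: E_def)
            ultimately show ?thesis by simp
          next
            case small: False
            show ?thesis
            proof (cases "p < Q * real N")
              case True
              have "u j powr (1 - \<alpha>) \<le> (Q * v) powr (1 - \<alpha>)"
                using small u0 \<alpha> by (intro powr_mono2) auto
              then have "v powr \<alpha> * u j powr (1 - \<alpha>) \<le> v powr \<alpha> * (Q * v) powr (1 - \<alpha>)"
                by (intro mult_left_mono) auto
              also have "\<dots> = Q powr (1 - \<alpha>) * (v powr \<alpha> * v powr (1 - \<alpha>))"
                using Q1 v0 by (simp add: powr_mult)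
              also have "\<dots> = Q powr (1 - \<alpha>) * v" using v0 by (simp add: powr_add[symmetric])
              also have "\<dots> \<le> Q powr 1 * v"
                using Q1 v0 \<alpha> by (intro mult_right_mono powr_mono) auto
              finally have "2 * (v powr \<alpha> * u j powr (1 - \<alpha>)) \<le> E * v"
                using True Q1 by (simp add: E_def)
              moreover have "\<kappa> * u j \<ge> 0" using u0 \<kappa>0 by simp
              ultimately show ?thesis by simp
            next
              case False
              \<comment> \<open>Integrality enters here: a nonzero entry would give u \<ge> 1 / N,
                whereas u < Q v \<le> Q / p \<le> 1 / N.\<close>
              have "x j = 0"
              proof (rule ccontr)
                assume "x j \<noteq> 0"
                then have "u j \<ge> 1 / real N"
                  unfolding u_def using xI xIN by (intro frac_le) auto
                moreover have "Q * v \<le> Q * (1 / p)" using vp Q1 by (intro mult_left_mono) auto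
                moreover have "Q * (1 / p) \<le> 1 / real N" using False p N1 by (simp add: field_simps)
                ultimately show False using small by linarith
              qed
              then show ?thesis using v0 Q1 by (simp add: u_def E_def)
            qed
          qed
          then show "2 * r ^ ?d I j * u j powr (1 - \<alpha>) \<le> \<kappa> * u j + E * (1 / p) ^ ?d I j"
            by (simp add: rv v_def[symmetric])
        qed (use \<alpha> p r0 I xI in \<open>auto simp: \<kappa>_def u_def\<close>)
        also have "\<dots> \<le> prime_loss Q C N p * (\<Sum>j\<le>J. u j) powr (2 - 2 * \<alpha>)"
        proof (rule mult_right_mono)
          have "8 * Q \<le> C" using R0 Q1 by (simp add: C_def)
          then show "1 + 4 * E / p \<le> prime_loss Q C N p"
            using p by (simp add: E_def prime_loss_def divide_right_mono)
        qed simp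
        finally have *: "(\<Sum>i\<le>J. \<Sum>j\<le>J. r ^ ?d i j * u i powr (1 - \<alpha>) * u j powr (1 - \<alpha>))
            \<le> prime_loss Q C N p * (\<Sum>j\<le>J. u j) powr (2 - 2 * \<alpha>)" .
        \<comment> \<open>Both sides are homogeneous of degree 2 - 2 \<alpha> in the entries, so the
          normalization can be undone.\<close>
        define c where "c = real (x I) powr (1 - \<alpha>)"
        have zu: "z j = c * u j powr (1 - \<alpha>)" for j
          unfolding z_def c_def u_def using xI by (simp add: powr_mult[symmetric])
        have "(\<Sum>i\<le>J. \<Sum>j\<le>J. r ^ ?d i j * z i * z j) =
            c\<^sup>2 * (\<Sum>i\<le>J. \<Sum>j\<le>J. r ^ ?d i j * u i powr (1 - \<alpha>) * u j powr (1 - \<alpha>))"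
          by (simp add: zu sum_distrib_left power2_eq_square mult_ac)
        also have "\<dots> \<le> c\<^sup>2 * (prime_loss Q C N p * (\<Sum>j\<le>J. u j) powr (2 - 2 * \<alpha>))"
          using * by (intro mult_left_mono) auto
        also have "c\<^sup>2 = real (x I) powr (2 - 2 * \<alpha>)"
          by (simp add: c_def power2_eq_square powr_add[symmetric])
        also have "\<dots> * (prime_loss Q C N p * (\<Sum>j\<le>J. u j) powr (2 - 2 * \<alpha>)) =
            prime_loss Q C N p * (real (x I) * (\<Sum>j\<le>J. u j)) powr (2 - 2 * \<alpha>)"
          by (subst powr_mult) (auto simp: u_def intro!: sum_nonneg)
        also have "real (x I) * (\<Sum>j\<le>J. u j) = real X"
          using xI by (simp add: u_def X_def sum_distrib_left)
        finally show ?thesis .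
      qed
    qed
    then show "(\<Sum>i\<le>J. \<Sum>j\<le>J. (p powr - \<alpha>) ^ ?d i j * real (x i) powr (1 - \<alpha>) * real (x j) powr (1 - \<alpha>))
      \<le> prime_loss Q C N p * real (\<Sum>j\<le>J. x j) powr (2 - 2 * \<alpha>)"
      by (simp add: r_def z_def X_def)
  qed
qed

text \<open>The kernel r^|i - j| is positive semidefinite: it is a sum of squares of the truncated
  geometric progressions below.\<close>

lemma power_dist_expansion:
  fixes r :: real
  assumes "i \<le> J" "j \<le> J"
  shows "r ^ ((i - j) + (j - i)) = (\<Sum>l\<le>J. (if l = 0 then 1 else 1 - r\<^sup>2) *
    (if l \<le> i then r ^ (i - l) else 0) * (if l \<le> j then r ^ (j - l) else 0))"
proof -
  \<comment> \<open>The weight 1 instead of 1 - r^2 at l = 0 stands for the tail of the geometric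
    series that is cut off below index 0.\<close>
  have tel: "(\<Sum>l\<le>i. (if l = 0 then 1 else 1 - r\<^sup>2) * r ^ (2 * (i - l))) = 1" for i
  proof (induction i)
    case (Suc i)
    have "(\<Sum>l\<le>i. (if l = 0 then 1 else 1 - r\<^sup>2) * r ^ (2 * (Suc i - l))) =
        (\<Sum>l\<le>i. r\<^sup>2 * ((if l = 0 then 1 else 1 - r\<^sup>2) * r ^ (2 * (i - l))))"
      by (intro sum.cong refl) (simp add: Suc_diff_le power2_eq_square)
    then show ?case using Suc by (simp add: sum_distrib_left[symmetric])
  qed simp
  have *: "r ^ (j - i) = (\<Sum>l\<le>J. (if l = 0 then 1 else 1 - r\<^sup>2) *
    (if l \<le> i then r ^ (i - l) else 0) * (if l \<le> j then r ^ (j - l) else 0))" if "i \<le> j" "j \<le> J" for i j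
  proof -
    have "(\<Sum>l\<le>J. (if l = 0 then 1 else 1 - r\<^sup>2) *
        (if l \<le> i then r ^ (i - l) else 0) * (if l \<le> j then r ^ (j - l) else 0)) =
      (\<Sum>l\<le>i. (if l = 0 then 1 else 1 - r\<^sup>2) *
        (if l \<le> i then r ^ (i - l) else 0) * (if l \<le> j then r ^ (j - l) else 0))"
      using that by (intro sum.mono_neutral_right) auto
    also have "\<dots> = (\<Sum>l\<le>i. r ^ (j - i) * ((if l = 0 then 1 else 1 - r\<^sup>2) * r ^ (2 * (i - l))))"
    proof (intro sum.cong refl)
      fix l assume l: "l \<in> {..i}"
      then have "r ^ (i - l) * r ^ (j - l) = r ^ (j - i) * r ^ (2 * (i - l))"
        using that by (auto simp flip: power_add intro!: arg_cong[where f = "\<lambda>n. r ^ n"])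
      then show "(if l = 0 then 1 else 1 - r\<^sup>2) *
          (if l \<le> i then r ^ (i - l) else 0) * (if l \<le> j then r ^ (j - l) else 0) =
          r ^ (j - i) * ((if l = 0 then 1 else 1 - r\<^sup>2) * r ^ (2 * (i - l)))"
        using l that by auto
    qed
    finally show ?thesis by (simp add: sum_distrib_left[symmetric] tel)
  qed
  show ?thesis
  proof (cases "i \<le> j")
    case True
    then show ?thesis using *[of i j] assms by simp
  next
    case False
    then show ?thesis using *[of j i] assms by (simp add: mult_ac)
  qed
qed

text \<open>Cauchy-Schwarz for a positive semidefinite form. It separates the fibre sizes of F from
  those of G, since the one-prime estimate treats a single sequence.\<close>

lemma power_dist_Cauchy_Schwarz:
  fixes r :: real and z w :: "nat \<Rightarrow> real"
  assumes "0 \<le> r" "r \<le> 1"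
  shows "(\<Sum>i\<le>J. \<Sum>j\<le>J. r ^ ((i - j) + (j - i)) * z i * w j)\<^sup>2 \<le>
    (\<Sum>i\<le>J. \<Sum>j\<le>J. r ^ ((i - j) + (j - i)) * z i * z j) *
    (\<Sum>i\<le>J. \<Sum>j\<le>J. r ^ ((i - j) + (j - i)) * w i * w j)"
proof -
  define c where "c l = (if l = 0 then 1 else 1 - r\<^sup>2)" for l :: nat
  define g where "g l i = (if l \<le> i then r ^ (i - l) else 0)" for l i :: nat
  define U where "U z l = sqrt (c l) * (\<Sum>i\<le>J. g l i * z i)" for z :: "nat \<Rightarrow> real" and l
  have c0: "c l \<ge> 0" for l using assms by (simp add: c_def power_le_one)
  have B: "(\<Sum>i\<le>J. \<Sum>j\<le>J. r ^ ((i - j) + (j - i)) * z i * w j) = (\<Sum>l\<le>J. U z l * U w l)" for z w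
  proof -
    have "(\<Sum>i\<le>J. \<Sum>j\<le>J. r ^ ((i - j) + (j - i)) * z i * w j) =
        (\<Sum>i\<le>J. \<Sum>j\<le>J. \<Sum>l\<le>J. c l * g l i * g l j * z i * w j)"
      by (intro sum.cong refl) (simp add: power_dist_expansion[where J = J] c_def g_def sum_distrib_right)
    also have "\<dots> = (\<Sum>i\<le>J. \<Sum>l\<le>J. \<Sum>j\<le>J. c l * g l i * g l j * z i * w j)"
      by (intro sum.cong refl sum.swap)
    also have "\<dots> = (\<Sum>l\<le>J. \<Sum>i\<le>J. \<Sum>j\<le>J. c l * g l i * g l j * z i * w j)"
      by (rule sum.swap)
    also have "\<dots> = (\<Sum>l\<le>J. c l * ((\<Sum>i\<le>J. g l i * z i) * (\<Sum>j\<le>J. g l j * w j)))"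
      by (simp add: sum_product sum_distrib_left mult_ac)
    also have "\<dots> = (\<Sum>l\<le>J. U z l * U w l)"
    proof (intro sum.cong refl)
      fix l
      have "c l = sqrt (c l) * sqrt (c l)" using c0 by simp
      then show "c l * ((\<Sum>i\<le>J. g l i * z i) * (\<Sum>j\<le>J. g l j * w j)) = U z l * U w l"
        by (simp add: U_def)
    qed
    finally show ?thesis .
  qed
  show ?thesis unfolding B using Cauchy_Schwarz_ineq_sum[of "U z" "U w" "{..J}"]
    by (simp add: power2_eq_square)
qed

section \<open>The upper bound\<close>

definition gcd_kernel :: "real \<Rightarrow> nat \<Rightarrow> nat \<Rightarrow> real" where
  "gcd_kernel \<alpha> m n = real (gcd m n) powr (2 * \<alpha>) / real (m * n) powr \<alpha>"

lemma gcd_sum_eq_kernel: "gcd_sum \<alpha> M = (\<Sum>m\<in>M. \<Sum>n\<in>M. gcd_kernel \<alpha> m n)"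
  by (simp add: gcd_sum_def gcd_kernel_def)

lemma gcd_kernel_commute: "gcd_kernel \<alpha> m n = gcd_kernel \<alpha> n m"
  by (simp add: gcd_kernel_def gcd.commute mult.commute)

lemma gcd_kernel_le_1:
  assumes "m > 0" "n > 0" "\<alpha> \<ge> 0"
  shows "gcd_kernel \<alpha> m n \<le> 1"
proof -
  have "gcd m n * gcd m n \<le> m * n"
    using assms by (intro mult_le_mono) (auto intro: dvd_imp_le)
  then have "real (gcd m n) * real (gcd m n) \<le> real (m * n)" by (metis of_nat_le_iff of_nat_mult)
  then have "(real (gcd m n) * real (gcd m n)) powr \<alpha> \<le> real (m * n) powr \<alpha>"
    using assms by (intro powr_mono2) auto
  moreover have "real (gcd m n) powr (2 * \<alpha>) = (real (gcd m n) * real (gcd m n)) powr \<alpha>"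
    by (simp add: powr_mult powr_add[symmetric])
  ultimately show ?thesis using assms by (simp add: gcd_kernel_def)
qed

text \<open>For i \<le> j the common factor p^i cancels from the kernel, and the surplus p^(j-i) is
  coprime to \<open>m\<close>, so it enters only the denominator.\<close>

lemma gcd_kernel_prime_power:
  assumes "prime p" "\<not> p dvd m" "\<not> p dvd n"
  shows "gcd_kernel \<alpha> (p ^ i * m) (p ^ j * n) = (real p powr - \<alpha>) ^ ((i - j) + (j - i)) * gcd_kernel \<alpha> m n"
proof -
  have *: "gcd_kernel \<alpha> (p ^ i * m) (p ^ j * n) = (real p powr - \<alpha>) ^ (j - i) * gcd_kernel \<alpha> m n"
    if "i \<le> j" and "\<not> p dvd m" "\<not> p dvd n" for i j m n
  proof -
    have p0: "real p > 0" using assms(1) prime_gt_0_nat by simp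
    have pj: "p ^ j = p ^ i * p ^ (j - i)" using that(1) by (metis le_add_diff_inverse power_add)
    have cop: "coprime m (p ^ (j - i))"
      using prime_imp_coprime[OF assms(1) that(2)] by (simp add: coprime_commute)
    have "gcd (p ^ i * m) (p ^ j * n) = p ^ i * gcd m (p ^ (j - i) * n)"
      unfolding pj by (simp add: mult.assoc gcd_mult_distrib_nat)
    also have "gcd m (p ^ (j - i) * n) = gcd m n"
      using cop by (simp add: gcd_mult_right_left_cancel)
    finally have g: "real (gcd (p ^ i * m) (p ^ j * n)) = real p ^ i * real (gcd m n)" by simp
    define P T where "P = real p ^ i" and "T = real p ^ (j - i)"
    have PT: "P > 0" "T > 0" using p0 by (simp_all add: P_def T_def)
    have mn: "real (p ^ i * m * (p ^ j * n)) = P * P * T * real (m * n)"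
      unfolding pj by (simp add: P_def T_def)
    have "gcd_kernel \<alpha> (p ^ i * m) (p ^ j * n) =
        (P * real (gcd m n)) powr (2 * \<alpha>) / (P * P * T * real (m * n)) powr \<alpha>"
      unfolding gcd_kernel_def g mn by (simp add: P_def)
    also have "\<dots> = P powr (2 * \<alpha>) / (P powr \<alpha> * P powr \<alpha>) * T powr - \<alpha> * gcd_kernel \<alpha> m n"
      unfolding gcd_kernel_def using PT by (simp add: powr_mult powr_minus field_simps)
    also have "P powr (2 * \<alpha>) / (P powr \<alpha> * P powr \<alpha>) = 1"
      using PT by (simp add: powr_add[symmetric])
    also have "T powr - \<alpha> = (real p powr - \<alpha>) ^ (j - i)"
      using p0 by (simp add: T_def powr_realpow[symmetric] powr_powr powr_power mult.commute)
    finally show ?thesis by simp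
  qed
  show ?thesis
  proof (cases "i \<le> j")
    case True
    then show ?thesis using *[of i j m n] assms by simp
  next
    case False
    then show ?thesis using *[of j i n m] assms by (simp add: gcd_kernel_commute)
  qed
qed

text \<open>Cofactors are stored, not elements of \<open>F\<close>: they are free of
  \<open>p\<close>, so the induction over the set of primes applies to the fibres.\<close>

definition prime_fiber :: "nat \<Rightarrow> nat set \<Rightarrow> nat \<Rightarrow> nat set" where
  "prime_fiber p F i = {m. p ^ i * m \<in> F \<and> \<not> p dvd m}"

lemma finite_prime_fiber:
  assumes "finite F" "p > 0"
  shows "finite (prime_fiber p F i)"
proof -
  have "finite ((\<lambda>m. p ^ i * m) -` F)" using assms by (intro finite_vimageI) (auto simp: inj_on_def)
  then show ?thesis by (rule rev_finite_subset) (auto simp: prime_fiber_def)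
qed

text \<open>Each positive m corresponds to its exponent of \<open>p\<close> and the cofactor.
  \<open>J\<close> may be any bound on the exponents, so that two sets can share one index
  range.\<close>

lemma sum_prime_fiber:
  fixes h :: "nat \<Rightarrow> 'a :: comm_monoid_add"
  assumes "finite F" "0 \<notin> F" "prime p" "\<And>m. m \<in> F \<Longrightarrow> multiplicity p m \<le> J"
  shows "(\<Sum>m\<in>F. h m) = (\<Sum>i\<le>J. \<Sum>m\<in>prime_fiber p F i. h (p ^ i * m))"
proof -
  have p0: "p > 0" and pu: "\<not> is_unit p" using assms(3) prime_gt_0_nat not_prime_unit by blast+
  have "(\<Sum>i\<le>J. \<Sum>m\<in>prime_fiber p F i. h (p ^ i * m)) =
      (\<Sum>(i, m)\<in>(SIGMA i:{..J}. prime_fiber p F i). h (p ^ i * m))"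
    using assms p0 by (subst sum.Sigma) (auto simp: finite_prime_fiber)
  also have "\<dots> = (\<Sum>m\<in>F. h m)"
  proof (rule sum.reindex_bij_witness[where j = "\<lambda>(i, m). p ^ i * m"
        and i = "\<lambda>m. (multiplicity p m, m div p ^ multiplicity p m)"])
    fix m assume m: "m \<in> F"
    then have "m \<noteq> 0" using assms(2) by metis
    then have nd: "\<not> p dvd m div p ^ multiplicity p m"
      using pu by (simp add: multiplicity_decompose)
    have eq: "p ^ multiplicity p m * (m div p ^ multiplicity p m) = m"
      by (simp add: multiplicity_dvd)
    then show "(case (multiplicity p m, m div p ^ multiplicity p m) of (i, m) \<Rightarrow> p ^ i * m) = m" by simp
    show "(multiplicity p m, m div p ^ multiplicity p m) \<in> (SIGMA i:{..J}. prime_fiber p F i)"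
      using assms(4)[OF m] nd eq m by (auto simp: prime_fiber_def)
  next
    fix y assume y: "y \<in> (SIGMA i:{..J}. prime_fiber p F i)"
    then obtain i m where im: "y = (i, m)" "p ^ i * m \<in> F" "\<not> p dvd m"
      by (auto simp: prime_fiber_def)
    have "multiplicity p (p ^ i * m) = i"
      using im pu assms(2) by (intro multiplicity_eqI) (auto simp: p0)
    then show "(multiplicity p (case y of (i, m) \<Rightarrow> p ^ i * m),
        (case y of (i, m) \<Rightarrow> p ^ i * m) div p ^ multiplicity p (case y of (i, m) \<Rightarrow> p ^ i * m)) = y"
      using im p0 by simp
    show "(case y of (i, m) \<Rightarrow> p ^ i * m) \<in> F" using im by simp
    show "h (case y of (i, m) \<Rightarrow> p ^ i * m) = (case y of (i, m) \<Rightarrow> h (p ^ i * m))" using im by simp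
  qed
  finally show ?thesis by simp
qed

text \<open>Induction on \<open>P\<close>. The induction hypothesis for a pair of fibres is again a
  product of powers 1 - \<alpha> of their sizes, so the sum over exponents i, j is a one-prime form
  in these sizes.\<close>

lemma gcd_form_le:
  fixes \<alpha> Q C :: real
  assumes \<alpha>: "0 < \<alpha>" "\<alpha> < 1/2" and C: "C > 0"
    and one: "\<And>p J x. p \<ge> 2 \<Longrightarrow> (\<Sum>j\<le>J. x j :: nat) \<le> N \<Longrightarrow>
      (\<Sum>i\<le>J. \<Sum>j\<le>J. (p powr - \<alpha>) ^ ((i - j) + (j - i)) * real (x i) powr (1 - \<alpha>) * real (x j) powr (1 - \<alpha>))
      \<le> prime_loss Q C N p * real (\<Sum>j\<le>J. x j) powr (2 - 2 * \<alpha>)"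
    and "finite P" "\<And>p. p \<in> P \<Longrightarrow> prime p"
    and "finite F" "finite G" "card F \<le> N" "card G \<le> N" "0 \<notin> F" "0 \<notin> G"
    and "\<And>m q. m \<in> F \<union> G \<Longrightarrow> prime q \<Longrightarrow> q dvd m \<Longrightarrow> q \<in> P"
  shows "(\<Sum>m\<in>F. \<Sum>n\<in>G. gcd_kernel \<alpha> m n) \<le>
    (\<Prod>p\<in>P. prime_loss Q C N (real p)) * (real (card F) powr (1 - \<alpha>) * real (card G) powr (1 - \<alpha>))"
  using assms(5-)
proof (induction P arbitrary: F G rule: finite_induct)
  case empty
  \<comment> \<open>Without prime divisors only the number 1 is left.\<close>
  have one: "F \<subseteq> {1}" "G \<subseteq> {1}"
    using empty.prems by (metis (no_types, lifting) UnI1 UnI2 empty_iff prime_factor_nat singletonI subsetI)+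
  show ?case
  proof (cases "F = {} \<or> G = {}")
    case False
    then have "F = {1}" "G = {1}" using one by auto
    then show ?thesis by (simp add: gcd_kernel_def)
  qed auto
next
  case (insert p P)
  have pp: "prime p" using insert.prems by simp
  have p2: "real p \<ge> 2" and p0: "p > 0" using prime_ge_2_nat[OF pp] by simp_all
  let ?d = "\<lambda>i j. (i - j) + (j - i) :: nat"
  \<comment> \<open>The inserted 0 keeps the maximum defined when both sets are empty.\<close>
  define J where "J = Max (insert 0 (multiplicity p ` (F \<union> G)))"
  have J: "multiplicity p m \<le> J" if "m \<in> F \<union> G" for m
    unfolding J_def using that insert.prems by (intro Max_ge) auto
  define r where "r = real p powr - \<alpha>"
  have r: "0 \<le> r" "r \<le> 1" using powr_mono[of "- \<alpha>" 0 "real p"] p2 \<alpha> by (simp_all add: r_def)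
  define \<Lambda> where "\<Lambda> = (\<Prod>p\<in>P. prime_loss Q C N (real p))"
  have loss0: "prime_loss Q C N q \<ge> 0" if "q \<ge> 0" for q using C that by (simp add: prime_loss_def)
  have \<Lambda>0: "\<Lambda> \<ge> 0" unfolding \<Lambda>_def using loss0 by (intro prod_nonneg) auto
  define x where "x i = card (prime_fiber p F i)" for i
  define y where "y i = card (prime_fiber p G i)" for i
  note sumF = sum_prime_fiber[OF insert.prems(2) insert.prems(6) pp J[OF UnI1]]
  note sumG = sum_prime_fiber[OF insert.prems(3) insert.prems(7) pp J[OF UnI2]]
  have X: "(\<Sum>i\<le>J. x i) = card F" and Y: "(\<Sum>i\<le>J. y i) = card G"
    using sumF[of "\<lambda>_. 1::nat"] sumG[of "\<lambda>_. 1::nat"] by (simp_all add: x_def y_def)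
  define z where "z i = real (x i) powr (1 - \<alpha>)" for i
  define w where "w i = real (y i) powr (1 - \<alpha>)" for i
  have key: "(\<Sum>i\<le>J. \<Sum>j\<le>J. r ^ ?d i j * z i * w j) \<le>
      prime_loss Q C N p * (real (card F) powr (1 - \<alpha>) * real (card G) powr (1 - \<alpha>))"
  proof (rule power2_le_imp_le)
    have sq: "real k powr (2 - 2 * \<alpha>) = (real k powr (1 - \<alpha>))\<^sup>2" for k
      by (simp add: power2_eq_square powr_add[symmetric])
    have "(\<Sum>i\<le>J. \<Sum>j\<le>J. r ^ ?d i j * z i * w j)\<^sup>2 \<le>
        (\<Sum>i\<le>J. \<Sum>j\<le>J. r ^ ?d i j * z i * z j) * (\<Sum>i\<le>J. \<Sum>j\<le>J. r ^ ?d i j * w i * w j)"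
      by (rule power_dist_Cauchy_Schwarz) (use r in auto)
    also have "\<dots> \<le> (prime_loss Q C N p * real (card F) powr (2 - 2 * \<alpha>)) *
        (prime_loss Q C N p * real (card G) powr (2 - 2 * \<alpha>))"
    proof (rule mult_mono)
      show "(\<Sum>i\<le>J. \<Sum>j\<le>J. r ^ ?d i j * z i * z j) \<le> prime_loss Q C N p * real (card F) powr (2 - 2 * \<alpha>)"
        using one[where p = "real p" and J = J and x = x] p2 X insert.prems by (simp add: r_def z_def)
      show "(\<Sum>i\<le>J. \<Sum>j\<le>J. r ^ ?d i j * w i * w j) \<le> prime_loss Q C N p * real (card G) powr (2 - 2 * \<alpha>)"
        using one[where p = "real p" and J = J and x = y] p2 Y insert.prems by (simp add: r_def w_def)
      show "0 \<le> prime_loss Q C N p * real (card F) powr (2 - 2 * \<alpha>)" using loss0 by simp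
      show "0 \<le> (\<Sum>i\<le>J. \<Sum>j\<le>J. r ^ ?d i j * w i * w j)"
        using r by (auto simp: w_def intro!: sum_nonneg mult_nonneg_nonneg)
    qed
    also have "\<dots> = (prime_loss Q C N p * (real (card F) powr (1 - \<alpha>) * real (card G) powr (1 - \<alpha>)))\<^sup>2"
      unfolding sq by (simp add: power2_eq_square mult_ac)
    finally show "(\<Sum>i\<le>J. \<Sum>j\<le>J. r ^ ?d i j * z i * w j)\<^sup>2 \<le>
        (prime_loss Q C N p * (real (card F) powr (1 - \<alpha>) * real (card G) powr (1 - \<alpha>)))\<^sup>2" .
  qed (use loss0 in simp)
  have "(\<Sum>m\<in>F. \<Sum>n\<in>G. gcd_kernel \<alpha> m n) =
      (\<Sum>i\<le>J. \<Sum>m\<in>prime_fiber p F i. \<Sum>j\<le>J. \<Sum>n\<in>prime_fiber p G j. gcd_kernel \<alpha> (p ^ i * m) (p ^ j * n))"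
    by (simp only: sumF sumG)
  also have "\<dots> = (\<Sum>i\<le>J. \<Sum>j\<le>J. \<Sum>m\<in>prime_fiber p F i. \<Sum>n\<in>prime_fiber p G j. gcd_kernel \<alpha> (p ^ i * m) (p ^ j * n))"
    by (intro sum.cong refl sum.swap)
  also have "\<dots> = (\<Sum>i\<le>J. \<Sum>j\<le>J. r ^ ?d i j * (\<Sum>m\<in>prime_fiber p F i. \<Sum>n\<in>prime_fiber p G j. gcd_kernel \<alpha> m n))"
    unfolding sum_distrib_left r_def
    by (intro sum.cong refl gcd_kernel_prime_power pp) (auto simp: prime_fiber_def)
  also have "\<dots> \<le> (\<Sum>i\<le>J. \<Sum>j\<le>J. r ^ ?d i j * (\<Lambda> * (z i * w j)))"
  proof (intro sum_mono mult_left_mono)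
    fix i j assume ij: "i \<in> {..J}" "j \<in> {..J}"
    have "x i \<le> card F" "y j \<le> card G"
      using X Y ij member_le_sum[of i "{..J}" x] member_le_sum[of j "{..J}" y] by simp_all
    then show "(\<Sum>m\<in>prime_fiber p F i. \<Sum>n\<in>prime_fiber p G j. gcd_kernel \<alpha> m n) \<le> \<Lambda> * (z i * w j)"
      unfolding \<Lambda>_def z_def w_def x_def y_def
    proof (intro insert.IH)
      fix m q assume m: "m \<in> prime_fiber p F i \<union> prime_fiber p G j" and q: "prime q" "q dvd m"
      then have "p ^ i * m \<in> F \<union> G \<or> p ^ j * m \<in> F \<union> G" "\<not> p dvd m" by (auto simp: prime_fiber_def)
      then have "q \<in> insert p P" using insert.prems(8) q by (meson dvd_mult)
      then show "q \<in> P" using q \<open>\<not> p dvd m\<close> by auto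
    qed (use insert.prems p0 finite_prime_fiber in \<open>auto simp: prime_fiber_def\<close>)
  qed (use r in auto)
  also have "\<dots> = \<Lambda> * (\<Sum>i\<le>J. \<Sum>j\<le>J. r ^ ?d i j * z i * w j)"
    by (simp add: sum_distrib_left mult_ac)
  also have "\<dots> \<le> \<Lambda> * (prime_loss Q C N p * (real (card F) powr (1 - \<alpha>) * real (card G) powr (1 - \<alpha>)))"
    using key \<Lambda>0 by (rule mult_left_mono)
  also have "\<Lambda> * (prime_loss Q C N p * (real (card F) powr (1 - \<alpha>) * real (card G) powr (1 - \<alpha>))) =
      (\<Prod>p\<in>insert p P. prime_loss Q C N (real p)) * (real (card F) powr (1 - \<alpha>) * real (card G) powr (1 - \<alpha>))"
    using insert.hyps by (simp add: \<Lambda>_def)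
  finally show ?case .
qed

text \<open>By 1 + t \<le> exp t. The bound is uniform in \<open>P\<close>, as primes beyond the
  threshold contribute the factor 1.\<close>

lemma prod_prime_loss_le:
  assumes "finite P" "\<And>p. p \<in> P \<Longrightarrow> prime p" "C > 0"
  shows "(\<Prod>p\<in>P. prime_loss Q C N (real p)) \<le>
    exp (C * (\<Sum>p | prime p \<and> real p \<le> Q * real N. 1 / real p))"
proof -
  let ?S = "{p. prime p \<and> real p \<le> Q * real N}"
  have "(\<Prod>p\<in>P. prime_loss Q C N (real p)) \<le> (\<Prod>p\<in>P. exp (if p \<in> ?S then C * (1 / real p) else 0))"
  proof (rule prod_mono, rule conjI)
    fix p assume p: "p \<in> P"
    show "0 \<le> prime_loss Q C N (real p)" using assms by (simp add: prime_loss_def)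
    show "prime_loss Q C N (real p) \<le> exp (if p \<in> ?S then C * (1 / real p) else 0)"
      using assms p exp_ge_add_one_self[of "C / real p"] by (auto simp: prime_loss_def)
  qed
  also have "\<dots> = exp (\<Sum>p\<in>P. if p \<in> ?S then C * (1 / real p) else 0)" using assms by (simp add: exp_sum)
  also have "(\<Sum>p\<in>P. if p \<in> ?S then C * (1 / real p) else 0) = (\<Sum>p\<in>P \<inter> ?S. C * (1 / real p))"
    by (rule sum.inter_restrict[symmetric]) (rule assms)
  also have "\<dots> \<le> (\<Sum>p\<in>?S. C * (1 / real p))"
    using assms finite_primes_le by (intro sum_mono2) auto
  finally show ?thesis by (simp add: sum_distrib_left)
qed

lemma gcd_sum_upper:
  fixes \<alpha> :: real
  assumes \<alpha>: "0 < \<alpha>" "\<alpha> < 1/2"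
  shows "\<exists>b>0. \<forall>\<^sub>F N in sequentially. \<forall>M. finite M \<longrightarrow> card M = N \<longrightarrow> 0 \<notin> M \<longrightarrow>
    gcd_sum \<alpha> M \<le> real N powr (2 - 2 * \<alpha>) * ln (real N) powr b"
proof -
  obtain Q C where Q: "Q \<ge> 1" and C: "C > 0" and one: "\<And>p N J x. p \<ge> 2 \<Longrightarrow> (\<Sum>j\<le>J. x j :: nat) \<le> N \<Longrightarrow>
      (\<Sum>i\<le>J. \<Sum>j\<le>J. (p powr - \<alpha>) ^ ((i - j) + (j - i)) * real (x i) powr (1 - \<alpha>) * real (x j) powr (1 - \<alpha>))
      \<le> prime_loss Q C N p * real (\<Sum>j\<le>J. x j) powr (2 - 2 * \<alpha>)"
    using power_dist_form_le[OF \<alpha>] by blast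
  \<comment> \<open>6 C is the coefficient of ln (ln (Q N)) in the exponent; one more power of ln N
    swallows exp (5 C) and the effect of \<open>Q\<close>.\<close>
  define b where "b = 6 * C + 1"
  have "\<forall>\<^sub>F N in sequentially. exp (C * (5 + 6 * ln (ln (Q * real N)))) \<le> ln (real N) powr b"
    unfolding b_def using Q C by real_asymp
  moreover have "\<forall>\<^sub>F N in sequentially. Q * real N \<ge> exp 1"
    using Q by real_asymp
  ultimately have "\<forall>\<^sub>F N in sequentially. \<forall>M. finite M \<longrightarrow> card M = N \<longrightarrow> 0 \<notin> M \<longrightarrow>
    gcd_sum \<alpha> M \<le> real N powr (2 - 2 * \<alpha>) * ln (real N) powr b"
  proof eventually_elim
    case (elim N)
    show ?case
    proof (intro allI impI)
      fix M :: "nat set" assume M: "finite M" "card M = N" "0 \<notin> M"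
      define P where "P = (\<Union>m\<in>M. {q. prime q \<and> q dvd m})"
      have P: "finite P" "\<And>p. p \<in> P \<Longrightarrow> prime p"
      proof -
        have "finite {q. prime q \<and> q dvd m}" if "m \<in> M" for m
          using that M by (intro finite_subset[OF _ finite_divisors_nat[of m]]) (auto intro: Nat.gr0I)
        then show "finite P" unfolding P_def using M by blast
      qed (simp add: P_def)
      have "gcd_sum \<alpha> M \<le> (\<Prod>p\<in>P. prime_loss Q C N (real p)) *
          (real (card M) powr (1 - \<alpha>) * real (card M) powr (1 - \<alpha>))"
        unfolding gcd_sum_eq_kernel
      proof (rule gcd_form_le[OF \<alpha> C one])
        show "q \<in> P" if "m \<in> M \<union> M" "prime q" "q dvd m" for m q using that unfolding P_def by blast
      qed (simp_all add: P M)
      also have "real (card M) powr (1 - \<alpha>) * real (card M) powr (1 - \<alpha>) = real N powr (2 - 2 * \<alpha>)"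
        by (simp add: M powr_add[symmetric])
      finally have *: "gcd_sum \<alpha> M \<le> (\<Prod>p\<in>P. prime_loss Q C N (real p)) * real N powr (2 - 2 * \<alpha>)" .
      have "(\<Prod>p\<in>P. prime_loss Q C N (real p)) \<le>
          exp (C * (\<Sum>p | prime p \<and> real p \<le> Q * real N. 1 / real p))"
        by (rule prod_prime_loss_le) (use P C in auto)
      also have "\<dots> \<le> exp (C * (5 + 6 * ln (ln (Q * real N))))"
        using C sum_inverse_primes_le[OF elim(2)] by simp
      also have "\<dots> \<le> ln (real N) powr b" by (rule elim(1))
      finally have "(\<Prod>p\<in>P. prime_loss Q C N (real p)) * real N powr (2 - 2 * \<alpha>) \<le>
          ln (real N) powr b * real N powr (2 - 2 * \<alpha>)" by (intro mult_right_mono) auto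
      with * show "gcd_sum \<alpha> M \<le> real N powr (2 - 2 * \<alpha>) * ln (real N) powr b"
        by (simp add: mult.commute)
    qed
  qed
  moreover have "b > 0" using C by (simp add: b_def)
  ultimately show ?thesis by blast
qed

section \<open>The lower bound\<close>

text \<open>A pair stands for the fraction a/b, measured by a * b because the kernel of two integers
  with reduced quotient c/d is (c d)^(-\<alpha>).\<close>

definition hyperbola :: "nat \<Rightarrow> (nat \<times> nat) set" where
  "hyperbola X = {(a, b). 1 \<le> a \<and> 1 \<le> b \<and> a * b \<le> X}"

lemma hyperbola_bounds:
  assumes "(a, b) \<in> hyperbola X"
  shows "a \<le> X" "b \<le> X"
proof -
  have ab: "1 \<le> a" "1 \<le> b" "a * b \<le> X" using assms by (auto simp: hyperbola_def)
  then have "a * 1 \<le> a * b" "1 * b \<le> a * b" by simp_all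
  then show "a \<le> X" "b \<le> X" using ab(3) by linarith+
qed

lemma finite_hyperbola: "finite (hyperbola X)"
  by (rule finite_subset[of _ "{..X} \<times> {..X}"]) (auto dest: hyperbola_bounds)

lemma card_hyperbola: "card (hyperbola X) = (\<Sum>b\<in>{1..X}. X div b)"
proof -
  have "hyperbola X = (\<lambda>(b, a). (a, b)) ` (SIGMA b:{1..X}. {1..X div b})"
  proof (intro set_eqI iffI)
    fix y assume "y \<in> hyperbola X"
    then obtain a b where y: "y = (a, b)" "1 \<le> a" "1 \<le> b" "a * b \<le> X" by (auto simp: hyperbola_def)
    moreover have "b \<le> X" using \<open>y \<in> hyperbola X\<close> y(1) hyperbola_bounds by blast
    moreover have "a \<le> X div b" using y by (simp add: less_eq_div_iff_mult_less_eq)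
    ultimately have "(b, a) \<in> (SIGMA b:{1..X}. {1..X div b})" by auto
    then show "y \<in> (\<lambda>(b, a). (a, b)) ` (SIGMA b:{1..X}. {1..X div b})" using y(1) by force
  qed (auto simp: hyperbola_def less_eq_div_iff_mult_less_eq)
  moreover have "inj_on (\<lambda>(b, a). (a, b)) (SIGMA b:{1..X}. {1..X div b})" by (auto simp: inj_on_def)
  ultimately show ?thesis by (simp add: card_image)
qed

text \<open>Telescoping with 1 / (g (g - 1)) from g = 3 on. A value below 1 is essential: it leaves
  a positive proportion of coprime pairs.\<close>

lemma sum_inverse_squares_le:
  "(\<Sum>g\<in>{2..n}. 1 / (real g)\<^sup>2) \<le> 3 / 4"
proof -
  have "(\<Sum>g\<in>{2..n}. 1 / (real g)\<^sup>2) \<le> 3 / 4 - 1 / real n" if "n \<ge> 2" for n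
    using that
  proof (induction n rule: dec_induct)
    case (step n)
    have "1 / (real (Suc n))\<^sup>2 \<le> 1 / (real n * real (Suc n))"
      using step by (intro divide_left_mono) (auto simp: power2_eq_square)
    also have "\<dots> = 1 / real n - 1 / real (Suc n)" using step by (simp add: field_simps)
    finally show ?case using step by simp
  qed simp
  moreover have "(\<Sum>g\<in>{2..n}. 1 / (real g)\<^sup>2) = 0" if "n < 2" using that by simp
  ultimately show ?thesis by (smt (verit) divide_nonneg_nonneg linorder_not_less of_nat_0_le_iff)
qed

text \<open>A union bound over the gcd instead of Moebius inversion: pairs with gcd g are g times
  pairs with product at most X / g^2. With H the harmonic sum, at least X H - X pairs exist and at
  most 3/4 of X H are not coprime.\<close>

lemma card_coprime_hyperbola_ge:
  "real X * (ln (real X) / 4 - 1) \<le> real (card {(a, b) \<in> hyperbola X. coprime a b})"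
proof (cases "X = 0")
  case False
  define H where "H = (\<Sum>b\<in>{1..X}. 1 / real b)"
  have H: "ln (real X) \<le> H"
  proof -
    have "ln (real X) \<le> ln (real X + 1)" using False by simp
    also have "\<dots> \<le> H" using ln_le_harm[of X] by (simp add: harm_def H_def inverse_eq_divide)
    finally show ?thesis .
  qed
  have H0: "H \<ge> 0" unfolding H_def by (intro sum_nonneg) auto
  \<comment> \<open>The harmonic sum up to X serves for every smaller Y, so the main terms of both
    counts are multiples of the same X H.\<close>
  have upper: "real (card (hyperbola Y)) \<le> real Y * H" if "Y \<le> X" for Y
  proof -
    have "real (card (hyperbola Y)) = (\<Sum>b\<in>{1..Y}. real (Y div b))" by (simp add: card_hyperbola)
    also have "\<dots> \<le> (\<Sum>b\<in>{1..Y}. real Y * (1 / real b))"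
      by (intro sum_mono) (use of_nat_div_le_of_nat in auto)
    also have "\<dots> \<le> (\<Sum>b\<in>{1..X}. real Y * (1 / real b))" using that by (intro sum_mono2) auto
    finally show ?thesis by (simp add: H_def sum_distrib_left)
  qed
  have lower: "real X * H - real X \<le> real (card (hyperbola X))"
  proof -
    have "real X * H - real X = (\<Sum>b\<in>{1..X}. real X / real b - 1)"
      by (simp add: H_def sum_distrib_left sum_subtractf)
    also have "\<dots> \<le> (\<Sum>b\<in>{1..X}. real (X div b))"
    proof (rule sum_mono)
      fix b assume "b \<in> {1..X}"
      show "real X / real b - 1 \<le> real (X div b)" using floor_correct[of "real X / real b"] by (simp add: floor_divide_of_nat_eq)
    qed
    finally show ?thesis by (simp add: card_hyperbola)
  qed
  let ?co = "{(a, b) \<in> hyperbola X. coprime a b}"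
  let ?im = "\<lambda>g::nat. (\<lambda>(a, b). (g * a, g * b)) ` hyperbola (X div g\<^sup>2)"
  have cover: "hyperbola X \<subseteq> ?co \<union> (\<Union>g\<in>{2..X}. ?im g)"
  proof
    fix y assume "y \<in> hyperbola X"
    then obtain a b where y: "y = (a, b)" "1 \<le> a" "1 \<le> b" "a * b \<le> X" by (auto simp: hyperbola_def)
    show "y \<in> ?co \<union> (\<Union>g\<in>{2..X}. ?im g)"
    proof (cases "coprime a b")
      case True
      then show ?thesis using y by (auto simp: hyperbola_def)
    next
      case False
      define g where "g = gcd a b"
      obtain a' b' where ab: "a = g * a'" "b = g * b'" unfolding g_def by (meson dvdE gcd_dvd1 gcd_dvd2)
      have "g \<noteq> 0" using y by (simp add: g_def)
      moreover have "g \<noteq> 1" using False by (metis coprime_iff_gcd_eq_1 g_def)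
      moreover have "a' \<ge> 1" "b' \<ge> 1" using ab y by (auto simp: Suc_le_eq intro: Nat.gr0I)
      moreover have "a' * b' * g\<^sup>2 \<le> X" using y ab by (simp add: power2_eq_square mult_ac)
      moreover have "g \<le> X"
      proof -
        have "g * 1 \<le> a * b" unfolding ab(1) using y ab \<open>a' \<ge> 1\<close> by (simp add: mult.assoc)
        then show ?thesis using y by simp
      qed
      ultimately have "g \<in> {2..X}" "(a', b') \<in> hyperbola (X div g\<^sup>2)"
        by (auto simp: hyperbola_def less_eq_div_iff_mult_less_eq)
      then have "y \<in> ?im g" "g \<in> {2..X}" using y ab by force+
      then show ?thesis by blast
    qed
  qed
  have finco: "finite ?co" using finite_hyperbola[of X] by (rule rev_finite_subset) auto
  have "card (hyperbola X) \<le> card (?co \<union> (\<Union>g\<in>{2..X}. ?im g))"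
    by (intro card_mono cover finite_UnI finco finite_UN_I finite_imageI finite_hyperbola) auto
  also have "\<dots> \<le> card ?co + card (\<Union>g\<in>{2..X}. ?im g)" by (rule card_Un_le)
  also have "card (\<Union>g\<in>{2..X}. ?im g) \<le> (\<Sum>g\<in>{2..X}. card (?im g))" by (rule card_UN_le) simp
  also have "\<dots> \<le> (\<Sum>g\<in>{2..X}. card (hyperbola (X div g\<^sup>2)))"
    by (intro sum_mono card_image_le finite_hyperbola)
  finally have nat: "card (hyperbola X) \<le> card ?co + (\<Sum>g\<in>{2..X}. card (hyperbola (X div g\<^sup>2)))"
    by simp
  have "real (card (hyperbola X)) \<le> real (card ?co) + (\<Sum>g\<in>{2..X}. real (card (hyperbola (X div g\<^sup>2))))"
    using of_nat_mono[OF nat, where 'a = real] by simp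
  also have "(\<Sum>g\<in>{2..X}. real (card (hyperbola (X div g\<^sup>2)))) \<le> (\<Sum>g\<in>{2..X}. real X * H * (1 / (real g)\<^sup>2))"
  proof (rule sum_mono)
    fix g
    have "real (card (hyperbola (X div g\<^sup>2))) \<le> real (X div g\<^sup>2) * H" by (intro upper) simp
    also have "\<dots> \<le> (real X / real (g\<^sup>2)) * H" by (intro mult_right_mono H0 of_nat_div_le_of_nat)
    finally show "real (card (hyperbola (X div g\<^sup>2))) \<le> real X * H * (1 / (real g)\<^sup>2)" by simp
  qed
  also have "\<dots> = real X * H * (\<Sum>g\<in>{2..X}. 1 / (real g)\<^sup>2)" by (simp add: sum_distrib_left)
  also have "\<dots> \<le> real X * H * (3 / 4)" using H0 by (intro mult_left_mono sum_inverse_squares_le) auto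
  finally have "real X * (H / 4 - 1) \<le> real (card ?co)" using lower by (simp add: algebra_simps)
  moreover have "real X * (ln (real X) / 4 - 1) \<le> real X * (H / 4 - 1)"
    using H by (intro mult_left_mono) auto
  ultimately show ?thesis by linarith
qed simp

text \<open>A real supremum dominates its members only once boundedness is known; the trivial
  estimate of the kernel by 1 gives the bound N.\<close>

lemma gcd_sum_le_Gamma:
  assumes "\<alpha> \<ge> 0" "finite M" "card M = N" "0 \<notin> M"
  shows "gcd_sum \<alpha> M / real N \<le> Gamma \<alpha> N"
  unfolding Gamma_def
proof (rule cSUP_upper)
  show "bdd_above ((\<lambda>M. gcd_sum \<alpha> M / real N) ` {M. finite M \<and> card M = N \<and> 0 \<notin> M})"
  proof (rule bdd_aboveI2[where M = "real N"])
    fix M :: "nat set" assume M: "M \<in> {M. finite M \<and> card M = N \<and> 0 \<notin> M}"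
    have "gcd_sum \<alpha> M \<le> (\<Sum>m\<in>M. \<Sum>n\<in>M. 1)"
      unfolding gcd_sum_eq_kernel using M assms
      by (intro sum_mono gcd_kernel_le_1) (auto intro!: Nat.gr0I)
    also have "\<dots> = real N * real N" using M by simp
    finally show "gcd_sum \<alpha> M / real N \<le> real N" by (cases "N = 0") (auto simp: field_simps)
  qed
qed (use assms in auto)

lemma gcd_kernel_fractions_ge:
  fixes a b c d F X :: nat
  assumes "\<alpha> \<ge> 0" "F > 0" "b dvd F" "d dvd F" "(a, b) \<in> hyperbola X" "(c, d) \<in> hyperbola X"
  shows "real X powr (- 2 * \<alpha>) \<le> gcd_kernel \<alpha> (a * (F div b)) (c * (F div d))"
proof -
  define m n where "m = a * (F div b)" and "n = c * (F div d)"
  have ab: "a > 0" "b > 0" "c > 0" "d > 0" "a * b \<le> X" "c * d \<le> X"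
    using assms by (auto simp: hyperbola_def)
  have mb: "m * b = a * F" and nd: "n * d = c * F"
    using assms by (auto simp: m_def n_def)
  have m0: "m > 0" and n0: "n > 0"
    using mb nd ab assms(2) by (metis mult_is_0 neq0_conv)+
  define g where "g = gcd m n"
  have g0: "g > 0" using m0 by (simp add: g_def)
  \<comment> \<open>The gcd is only bounded from below, by F / (b d); inserting this into b d * m n
    = a c * F^2 gives m n \<le> (a b) (c d) g^2.\<close>
  have "F dvd b * d * m" "F dvd b * d * n"
    using mb nd by (metis dvd_triv_right dvd_mult mult.assoc mult.commute)+
  then have "F dvd b * d * g" unfolding g_def by (metis gcd_greatest gcd_mult_distrib_nat)
  then have F: "F \<le> b * d * g" using ab g0 by (intro dvd_imp_le) auto
  have "(b * d) * (m * n) = (a * c) * (F * F)" using mb nd by (metis mult.assoc mult.commute)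
  also have "\<dots> \<le> (a * c) * ((b * d * g) * (b * d * g))" using F by (intro mult_le_mono) auto
  also have "\<dots> = (b * d) * ((a * b) * (c * d) * (g * g))" by (simp add: mult_ac)
  finally have "m * n \<le> (a * b) * (c * d) * (g * g)" using ab by simp
  also have "\<dots> \<le> X * X * (g * g)" using ab by (intro mult_le_mono) auto
  finally have "real (m * n) \<le> real X * real X * (real g * real g)" by (metis of_nat_le_iff of_nat_mult)
  then have "real (m * n) powr \<alpha> \<le> (real X * real X * (real g * real g)) powr \<alpha>"
    using assms by (intro powr_mono2) auto
  also have "\<dots> = real X powr (2 * \<alpha>) * real g powr (2 * \<alpha>)"
    by (simp add: powr_mult powr_add[symmetric])
  finally have *: "real (m * n) powr \<alpha> \<le> real X powr (2 * \<alpha>) * real g powr (2 * \<alpha>)" .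
  have X0: "X > 0" using ab by (metis le_zero_eq mult_is_0 neq0_conv)
  have "real X powr (- 2 * \<alpha>) = 1 / real X powr (2 * \<alpha>)" by (simp add: powr_minus_divide)
  also have "\<dots> \<le> real g powr (2 * \<alpha>) / real (m * n) powr \<alpha>"
    using * X0 m0 n0 by (simp add: field_simps)
  finally show ?thesis by (simp add: gcd_kernel_def m_def n_def g_def)
qed

text \<open>All N^2 summands are at least X^(-2 \<alpha>). Coprimality makes distinct pairs give
  distinct fractions, hence distinct integers after multiplication by the common
  denominator.\<close>

lemma Gamma_ge_of_hyperbola:
  assumes "\<alpha> \<ge> 0" "N > 0" "N \<le> card {(a, b) \<in> hyperbola X. coprime a b}"
  shows "real N * real X powr (- 2 * \<alpha>) \<le> Gamma \<alpha> N"
proof -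
  let ?co = "{(a, b) \<in> hyperbola X. coprime a b}"
  \<comment> \<open>A common denominator: every b in the hyperbola is at most X.\<close>
  define F where "F = (fact X :: nat)"
  define f where "f = (\<lambda>(a, b). a * (F div b))"
  have F0: "F > 0" by (simp add: F_def)
  have dvdF: "b dvd F" if "(a, b) \<in> hyperbola X" for a b
  proof -
    have "b \<ge> 1" "b \<le> X" using that hyperbola_bounds[OF that] by (auto simp: hyperbola_def)
    then show ?thesis unfolding F_def by (intro dvd_fact) auto
  qed
  have "inj_on f ?co"
  proof (rule inj_onI, clarsimp simp: f_def)
    fix a b c d assume h: "(a, b) \<in> hyperbola X" "(c, d) \<in> hyperbola X"
      and cop: "coprime a b" "coprime c d" and eq: "a * (F div b) = c * (F div d)"
    have "(a * (F div b)) * (b * d) = (c * (F div d)) * (b * d)" using eq by simp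
    moreover have "(a * (F div b)) * (b * d) = (a * d) * F"
      using dvdF[OF h(1)] by (metis dvd_div_mult_self mult.assoc mult.commute)
    moreover have "(c * (F div d)) * (b * d) = (c * b) * F"
      using dvdF[OF h(2)] by (metis dvd_div_mult_self mult.assoc mult.commute)
    ultimately have ad: "a * d = c * b" using F0 by simp
    have "a dvd c" using ad cop(1) by (metis coprime_dvd_mult_left_iff dvd_triv_left)
    moreover have "c dvd a" using ad cop(2) by (metis coprime_dvd_mult_left_iff dvd_triv_left)
    ultimately have "a = c" by (rule dvd_antisym)
    then show "a = c \<and> b = d" using ad h by (auto simp: hyperbola_def)
  qed
  then have "N \<le> card (f ` ?co)" using assms by (simp add: card_image)
  from obtain_subset_with_card_n[OF this]
  obtain M where M: "M \<subseteq> f ` ?co" "card M = N" "finite M" by blast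
  have fraction: "\<exists>a b. (a, b) \<in> hyperbola X \<and> m = a * (F div b)" if "m \<in> f ` ?co" for m
    using that
  proof (rule imageE)
    fix y assume y: "m = f y" "y \<in> ?co"
    obtain a b where "y = (a, b)" by (cases y)
    with y have "(a, b) \<in> hyperbola X \<and> m = a * (F div b)" by (simp add: f_def)
    then show ?thesis by blast
  qed
  have "0 \<notin> f ` ?co"
  proof
    assume "0 \<in> f ` ?co"
    from fraction[OF this] obtain a b where ab: "(a, b) \<in> hyperbola X" "a * (F div b) = 0" by metis
    moreover have "a \<noteq> 0" using ab(1) by (simp add: hyperbola_def)
    ultimately have "F div b * b = 0" by (metis mult_is_0)
    then show False using dvdF[OF ab(1)] F0 by simp
  qed
  then have M0: "0 \<notin> M" using M by blast
  have "real N * real N * real X powr (- 2 * \<alpha>) = (\<Sum>m\<in>M. \<Sum>n\<in>M. real X powr (- 2 * \<alpha>))"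
    using M by simp
  also have "\<dots> \<le> gcd_sum \<alpha> M" unfolding gcd_sum_eq_kernel
  proof (intro sum_mono)
    fix m n assume "m \<in> M" "n \<in> M"
    then have "m \<in> f ` ?co" "n \<in> f ` ?co" using M(1) by blast+
    from this[THEN fraction] obtain a b c d where "(a, b) \<in> hyperbola X" "(c, d) \<in> hyperbola X"
      "m = a * (F div b)" "n = c * (F div d)" by blast
    then show "real X powr (- 2 * \<alpha>) \<le> gcd_kernel \<alpha> m n"
      using gcd_kernel_fractions_ge[OF assms(1) F0] dvdF by blast
  qed
  finally have "real N * real X powr (- 2 * \<alpha>) \<le> gcd_sum \<alpha> M / real N"
    using assms(2) by (simp add: field_simps)
  also have "\<dots> \<le> Gamma \<alpha> N" by (rule gcd_sum_le_Gamma) (use assms M M0 in auto)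
  finally show ?thesis .
qed

lemma Gamma_lower:
  fixes \<alpha> :: real
  assumes "\<alpha> > 0"
  shows "\<forall>\<^sub>F N in sequentially. real N powr (1 - 2 * \<alpha>) * ln (real N) powr \<alpha> \<le> Gamma \<alpha> N"
proof -
  \<comment> \<open>About Y ln Y / 4, of order N times the root of ln N, coprime pairs are
    available, eventually more than N; and Y^(-2 \<alpha>) = N^(-2 \<alpha>) (ln N)^\<alpha>, whence
    a = \<alpha>.\<close>
  define Y where "Y N = real N / sqrt (ln (real N))" for N :: nat
  have "\<forall>\<^sub>F N in sequentially. Y N - 1 \<ge> exp 4" unfolding Y_def by real_asymp
  moreover have "\<forall>\<^sub>F N in sequentially. (Y N - 1) * (ln (Y N - 1) / 4 - 1) \<ge> real N" unfolding Y_def by real_asymp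
  moreover have "\<forall>\<^sub>F N in sequentially. real N > 1" by real_asymp
  ultimately show ?thesis
  proof eventually_elim
    case (elim N)
    define X where "X = nat \<lfloor>Y N\<rfloor>"
    have Y0: "Y N - 1 > 0" using elim(1) by (meson exp_gt_zero less_le_trans)
    have X: "Y N - 1 \<le> real X" "real X \<le> Y N" unfolding X_def using Y0 by linarith+
    \<comment> \<open>The value 4 makes ln / 4 - 1 nonnegative, so both factors of the count may be
      replaced by their values at \<open>X\<close>.\<close>
    have l4: "ln (Y N - 1) \<ge> 4" using elim(1) Y0 by (simp add: ln_ge_iff)
    have "real N \<le> (Y N - 1) * (ln (Y N - 1) / 4 - 1)" by (rule elim(2))
    also have "\<dots> \<le> real X * (ln (real X) / 4 - 1)"
      using X Y0 l4 by (intro mult_mono) auto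
    also have "\<dots> \<le> real (card {(a, b) \<in> hyperbola X. coprime a b})" by (rule card_coprime_hyperbola_ge)
    finally have "N \<le> card {(a, b) \<in> hyperbola X. coprime a b}" by simp
    then have "real N * real X powr (- 2 * \<alpha>) \<le> Gamma \<alpha> N"
      using assms elim(3) by (intro Gamma_ge_of_hyperbola) auto
    moreover have "real N powr (1 - 2 * \<alpha>) * ln (real N) powr \<alpha> = real N * Y N powr (- 2 * \<alpha>)"
    proof -
      have ln0: "ln (real N) > 0" using elim(3) by simp
      have "Y N powr (- 2 * \<alpha>) = real N powr (- 2 * \<alpha>) * ln (real N) powr \<alpha>"
        unfolding Y_def using ln0 by (simp add: powr_divide powr_minus powr_half_sqrt[symmetric] powr_powr field_simps)
      moreover have "real N powr (1 - 2 * \<alpha>) = real N * real N powr (- 2 * \<alpha>)"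
        using elim(3) by (simp add: powr_diff powr_minus divide_inverse)
      ultimately show ?thesis by simp
    qed
    moreover have "real N * Y N powr (- 2 * \<alpha>) \<le> real N * real X powr (- 2 * \<alpha>)"
      using X Y0 assms by (intro mult_left_mono powr_mono2') auto
    ultimately show ?case by linarith
  qed
qed

theorem theorem1:
  fixes \<alpha> :: real
  assumes "0 < \<alpha>" and "\<alpha> < 1/2"
  shows "\<exists>a b. a > 0 \<and> b > 0 \<and>
    (\<forall>\<^sub>F N in sequentially.
       real N powr (1 - 2*\<alpha>) * ln (real N) powr a \<le> Gamma \<alpha> N \<and>
       Gamma \<alpha> N \<le> real N powr (1 - 2*\<alpha>) * ln (real N) powr b)"
proof -
  obtain b where b: "b > 0" and up: "\<forall>\<^sub>F N in sequentially. \<forall>M. finite M \<longrightarrow> card M = N \<longrightarrow> 0 \<notin> M \<longrightarrow>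
    gcd_sum \<alpha> M \<le> real N powr (2 - 2 * \<alpha>) * ln (real N) powr b"
    using gcd_sum_upper[OF assms] by blast
  have "\<forall>\<^sub>F N in sequentially.
       real N powr (1 - 2*\<alpha>) * ln (real N) powr \<alpha> \<le> Gamma \<alpha> N \<and>
       Gamma \<alpha> N \<le> real N powr (1 - 2*\<alpha>) * ln (real N) powr b"
    using up Gamma_lower[OF assms(1)] eventually_gt_at_top[of 0]
  proof eventually_elim
    case (elim N)
    have "Gamma \<alpha> N \<le> real N powr (1 - 2*\<alpha>) * ln (real N) powr b"
      unfolding Gamma_def
    proof (rule cSUP_least)
      \<comment> \<open>Witness that the supremum ranges over a nonempty family.\<close>
      have "{1..N} \<in> {M. finite M \<and> card M = N \<and> 0 \<notin> M}" by simp
      then show "{M. finite M \<and> card M = N \<and> 0 \<notin> M} \<noteq> ({} :: nat set set)" by blast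
      fix M :: "nat set" assume "M \<in> {M. finite M \<and> card M = N \<and> 0 \<notin> M}"
      then have "gcd_sum \<alpha> M \<le> real N powr (2 - 2 * \<alpha>) * ln (real N) powr b" using elim(1) by blast
      moreover have "real N powr (2 - 2 * \<alpha>) = real N powr (1 - 2 * \<alpha>) * real N"
        using elim(3) powr_add[of "real N" "1 - 2 * \<alpha>" 1] by simp
      ultimately show "gcd_sum \<alpha> M / real N \<le> real N powr (1 - 2*\<alpha>) * ln (real N) powr b"
        using elim(3) by (simp add: field_simps)
    qed
    then show ?case using elim(2) by blast
  qed
  then show ?thesis using assms(1) b by blast
qed

end
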